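(* Let $\phi:\mathbb{P}^2 \dashrightarrow \mathbb{P}^3$ be a rational map as in the context, with image surface $S$, and suppose there exists an inversion matrix $\mathbb{M}$ of $\phi$ (with associated integer $m$, monomial set $V=\{\mathbf{t}^{\alpha_1},\dots,\mathbf{t}^{\alpha_d}\}$ and monomials $\mathbf{t}^{\beta_1},\mathbf{t}^{\beta_2},\mathbf{t}^{\beta_3}\in V$ with $t_1\mathbf{t}^{\beta_3}=t_3\mathbf{t}^{\beta_1}$ and $t_2\mathbf{t}^{\beta_3}=t_3\mathbf{t}^{\beta_2}$). Then $\phi$, co-restricted to $S$, is birational (i.e. $\deg(\phi)=1$). Moreover, the rational map $$S\subset\mathbb{P}^3 \dashrightarrow \mathbb{P}^2,\qquad \underline{X}\mapsto \big(\Delta_{\beta_1}(\underline{X}):\Delta_{\beta_2}(\underline{X}):\Delta_{\beta_3}(\underline{X})\big)$$ is an inverse of $\phi$, where $\Delta_{\alpha}$ denotes the signed maximal minor of $\mathbb{M}$ obtained by erasing the row indexed by $\mathbf{t}^{\alpha}$.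
   Context: $\mathbb{K}$ is a field of characteristic zero. $\phi:\mathbb{P}^2\dashrightarrow\mathbb{P}^3$, $\mathbf{t}=(t_1:t_2:t_3)\mapsto (p_1(\mathbf{t}):p_2(\mathbf{t}):p_3(\mathbf{t}):p_4(\mathbf{t}))$, where $p_1,\dots,p_4\in\mathbb{K}[t_1,t_2,t_3]$ are homogeneous of the same degree, and $\phi$ is generically finite, so the closure of its image is an irreducible surface $S\subset\mathbb{P}^3$. Let $F\in\mathbb{K}[X_1,X_2,X_3,X_4]$ be the implicit equation of $S$ (the irreducible homogeneous polynomial of minimal degree with $F(p_1,\dots,p_4)\equiv 0$, defined up to a nonzero constant). $\mathbb{K}(S)$ denotes the field of rational functions of $S$ (rank over $\mathbb{K}(S)$ of a matrix with entries in $\mathbb{K}[\underline{X}]$ means rank of its image over the fraction field of $\mathbb{K}[\underline{X}]/(F)$), and $\mathbb{K}(\mathbb{P}^2)$ that of $\mathbb{P}^2$. $\phi$ induces an injective field morphism $\phi^\sharp:\mathbb{K}(S)\to\mathbb{K}(\mathbb{P}^2)$, $f\mapsto f\circ\phi$; $\deg(\phi):=[\mathbb{K}(\mathbb{P}^2):\mathbb{K}(S)]$, and $\phi$ is birational iff $\deg(\phi)=1$. A moving surface of bi-degree $(m;n)$ ($m,n\ge1$) is a polynomial $M(\mathbf{t};\underline{X})=\sum_{|\alpha|=n}A_\alpha(\mathbf{t})\underline{X}^\alpha$, bihomogeneous of degree $m$ in $\mathbf{t}=(t_1,t_2,t_3)$ and $n$ in $\underline{X}=(X_1,\dots,X_4)$.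 It follows $\phi$ if $M(\mathbf{t};p_1(\mathbf{t}),\dots,p_4(\mathbf{t}))=0$ identically. An inversion matrix of $\phi$ is a $d\times(d-1)$ matrix $\mathbb{M}$ with entries in $\mathbb{K}[\underline{X}]$ such that: (i) there exist an integer $m\ge1$ and distinct monomials $\mathbf{t}^{\alpha_1},\dots,\mathbf{t}^{\alpha_d}$ of degree $m$ in $\mathbf{t}$ (rows of $\mathbb{M}$ indexed by them) with ${}^t\mathbb{M}\,(\mathbf{t}^{\alpha_1},\dots,\mathbf{t}^{\alpha_d})^t=(M_1(\mathbf{t};\underline{X}),\dots,M_{d-1}(\mathbf{t};\underline{X}))^t$, each $M_i$ a moving surface of bi-degree $(m;d_i)$ following $\phi$, and there exist $\mathbf{t}^{\beta_1},\mathbf{t}^{\beta_2},\mathbf{t}^{\beta_3}$ among the $\mathbf{t}^{\alpha_i}$ with $t_1\mathbf{t}^{\beta_3}=t_3\mathbf{t}^{\beta_1}$ and $t_2\mathbf{t}^{\beta_3}=t_3\mathbf{t}^{\beta_2}$; (ii) the rank of $\mathbb{M}$ over $\mathbb{K}(S)$ is exactly $d-1$. Signed minors: $\Delta_{\alpha_i}=(-1)^{i}\det(\mathbb{M}_{\hat i})$, where $\mathbb{M}_{\hat i}$ is $\mathbb{M}$ with the row indexed by $\mathbf{t}^{\alpha_i}$ deleted (alternating signs, so that $(\Delta_{\alpha_1},\dots,\Delta_{\alpha_d})$ lies in the kernel of ${}^t\mathbb{M}$). *)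

theory Defs
  imports "HOL-Library.Poly_Mapping" "HOL-Computational_Algebra.Polynomial"
    "Jordan_Normal_Form.Determinant" "Jordan_Normal_Form.DL_Submatrix"
begin

(* Multivariate polynomials: finitely supported maps from exponent vectors
   (nat \<Rightarrow>\<^sub>0 nat, variable i has index i, 0-based) to coefficients. *)
type_synonym 'a mpoly = "(nat \<Rightarrow>\<^sub>0 nat) \<Rightarrow>\<^sub>0 'a"

definition mvar :: "nat \<Rightarrow> 'a::comm_ring_1 mpoly" where
  "mvar i = Poly_Mapping.single (Poly_Mapping.single i 1) 1"

definition tdeg :: "(nat \<Rightarrow>\<^sub>0 nat) \<Rightarrow> nat" where
  "tdeg \<alpha> = (\<Sum>i\<in>Poly_Mapping.keys \<alpha>. Poly_Mapping.lookup \<alpha> i)"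

definition ptdeg :: "'a::zero mpoly \<Rightarrow> nat" where
  "ptdeg P = Max (tdeg ` Poly_Mapping.keys P)"

definition mvars :: "('b::zero) mpoly \<Rightarrow> nat set" where
  "mvars P = \<Union> (Poly_Mapping.keys ` Poly_Mapping.keys P)"

definition homog :: "nat \<Rightarrow> ('b::zero) mpoly \<Rightarrow> bool" where
  "homog n P \<longleftrightarrow> (\<forall>\<alpha>\<in>Poly_Mapping.keys P. tdeg \<alpha> = n)"

definition mpoly_subst :: "'a::comm_ring_1 mpoly \<Rightarrow> (nat \<Rightarrow> 'a mpoly) \<Rightarrow> 'a mpoly" where
  "mpoly_subst P q =
     (\<Sum>\<alpha>\<in>Poly_Mapping.keys P. Poly_Mapping.single 0 (Poly_Mapping.lookup P \<alpha>) * (\<Prod>i\<in>Poly_Mapping.keys \<alpha>. q i ^ Poly_Mapping.lookup \<alpha> i))"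

(* phi = (p 0 : p 1 : p 2 : p 3), homogeneous of the same degree in t = variables 0,1,2 *)
definition param :: "(nat \<Rightarrow> 'a::comm_ring_1 mpoly) \<Rightarrow> bool" where
  "param p \<longleftrightarrow> (\<exists>e. \<forall>i<4. mvars (p i) \<subseteq> {..<3} \<and> homog e (p i))"

(* generically finite: K(t1,t2,t3) is algebraic over K(p1,...,p4), i.e. each t_j is a root of a
   polynomial with coefficients in K[p1..p4] which is nonzero after substitution *)
definition generically_finite :: "(nat \<Rightarrow> 'a::comm_ring_1 mpoly) \<Rightarrow> bool" where
  "generically_finite p \<longleftrightarrow>
     (\<forall>j<3. \<exists>Q :: 'a mpoly poly.
        (\<forall>k. mvars (coeff Q k) \<subseteq> {..<4}) \<and>
        map_poly (\<lambda>c. mpoly_subst c p) Q \<noteq> 0 \<and>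
        poly (map_poly (\<lambda>c. mpoly_subst c p) Q) (mvar j) = 0)"

definition implicit_eq :: "(nat \<Rightarrow> 'a::comm_ring_1 mpoly) \<Rightarrow> 'a mpoly \<Rightarrow> bool" where
  "implicit_eq p F \<longleftrightarrow>
     mvars F \<subseteq> {..<4} \<and> (\<exists>n. homog n F) \<and> irreducible F \<and> mpoly_subst F p = 0 \<and>
     (\<forall>G. G \<noteq> 0 \<and> mvars G \<subseteq> {..<4} \<and> (\<exists>n. homog n G) \<and> mpoly_subst G p = 0
          \<longrightarrow> ptdeg F \<le> ptdeg G)"

(* moving surfaces: polynomials in X (outer, variables 0..3) whose coefficients
   A_alpha(t) are polynomials in t (variables 0..2) *)
definition moving_surface :: "nat \<Rightarrow> nat \<Rightarrow> 'a::comm_ring_1 mpoly mpoly \<Rightarrow> bool" where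
  "moving_surface m n M \<longleftrightarrow> m \<ge> 1 \<and> n \<ge> 1 \<and> mvars M \<subseteq> {..<4} \<and> homog n M \<and>
     (\<forall>\<alpha>\<in>Poly_Mapping.keys M. mvars (Poly_Mapping.lookup M \<alpha>) \<subseteq> {..<3} \<and> homog m (Poly_Mapping.lookup M \<alpha>))"

definition follows :: "(nat \<Rightarrow> 'a::comm_ring_1 mpoly) \<Rightarrow> 'a mpoly mpoly \<Rightarrow> bool" where
  "follows p M \<longleftrightarrow> (\<Sum>\<alpha>\<in>Poly_Mapping.keys M. Poly_Mapping.lookup M \<alpha> * (\<Prod>i\<in>Poly_Mapping.keys \<alpha>. p i ^ Poly_Mapping.lookup \<alpha> i)) = 0"

(* the i-th entry of  ^t M (t^alpha_1, ..., t^alpha_d)^t *)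
definition col_surface :: "'a::comm_ring_1 mpoly mat \<Rightarrow> (nat \<Rightarrow> (nat \<Rightarrow>\<^sub>0 nat)) \<Rightarrow> nat \<Rightarrow> 'a mpoly mpoly" where
  "col_surface A \<alpha> i = (\<Sum>j<dim_row A. Poly_Mapping.map (\<lambda>c. Poly_Mapping.single (\<alpha> j) c) (A $$ (j, i)))"

(* determinantal rank over K(S) = Frac(K[X]/(F)): largest size of a minor not in (F) *)
definition rank_KS :: "'a::comm_ring_1 mpoly \<Rightarrow> 'a mpoly mat \<Rightarrow> nat" where
  "rank_KS F A = (GREATEST r. \<exists>I J. I \<subseteq> {..<dim_row A} \<and> J \<subseteq> {..<dim_col A} \<and>
      card I = r \<and> card J = r \<and> \<not> F dvd det (submatrix A I J))"

definition inversion_matrix ::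
  "(nat \<Rightarrow> 'a::comm_ring_1 mpoly) \<Rightarrow> 'a mpoly \<Rightarrow> 'a mpoly mat \<Rightarrow> nat \<Rightarrow> nat \<Rightarrow>
   (nat \<Rightarrow> (nat \<Rightarrow>\<^sub>0 nat)) \<Rightarrow> nat \<Rightarrow> nat \<Rightarrow> nat \<Rightarrow> bool" where
  "inversion_matrix p F A d m \<alpha> b1 b2 b3 \<longleftrightarrow>
     dim_row A = d \<and> dim_col A = d - 1 \<and> m \<ge> 1 \<and>
     (\<forall>j<d. \<forall>i<d - 1. mvars (A $$ (j, i)) \<subseteq> {..<4}) \<and>
     inj_on \<alpha> {..<d} \<and> (\<forall>j<d. Poly_Mapping.keys (\<alpha> j) \<subseteq> {..<3} \<and> tdeg (\<alpha> j) = m) \<and>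
     (\<forall>i<d - 1. \<exists>di. moving_surface m di (col_surface A \<alpha> i) \<and> follows p (col_surface A \<alpha> i)) \<and>
     b1 < d \<and> b2 < d \<and> b3 < d \<and>
     Poly_Mapping.single 0 1 + \<alpha> b3 = Poly_Mapping.single 2 1 + \<alpha> b1 \<and>
     Poly_Mapping.single 1 1 + \<alpha> b3 = Poly_Mapping.single 2 1 + \<alpha> b2 \<and>
     rank_KS F A = d - 1"

(* signed maximal minor: row k (0-based, i.e. row k+1 in the paper's numbering) deleted *)
definition signed_minor :: "'a::comm_ring_1 mpoly mat \<Rightarrow> nat \<Rightarrow> 'a mpoly" where
  "signed_minor A k = (-1) ^ (k + 1) * det (submatrix A ({..<dim_row A} - {k}) {..<dim_col A})"

definition rational_inverse :: "(nat \<Rightarrow> 'a::comm_ring_1 mpoly) \<Rightarrow> 'a mpoly \<Rightarrow> (nat \<Rightarrow> 'a mpoly) \<Rightarrow> bool" where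
  "rational_inverse p F q \<longleftrightarrow>
     (\<forall>i<3. mvars (q i) \<subseteq> {..<4}) \<and> (\<exists>n. \<forall>i<3. homog n (q i)) \<and>
     (\<exists>i<3. mpoly_subst (q i) p \<noteq> 0) \<and>
     (\<forall>i<3. \<forall>j<3. mpoly_subst (q i) p * mvar j = mpoly_subst (q j) p * mvar i) \<and>
     (\<exists>i<4. \<not> F dvd mpoly_subst (p i) q) \<and>
     (\<forall>i<4. \<forall>j<4. F dvd (mpoly_subst (p i) q * mvar j - mpoly_subst (p j) q * mvar i))"

definition birational :: "(nat \<Rightarrow> 'a::comm_ring_1 mpoly) \<Rightarrow> 'a mpoly \<Rightarrow> bool" where
  "birational p F \<longleftrightarrow> (\<exists>q. rational_inverse p F q)"

end

(*
  Let \<psi> be the substitution X = p(t) and suppose that the kernel of \<psi> is (F).  Then some maximal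
  minor of A stays nonzero under \<psi>; both the monomial vector (t^\<alpha>_j) and the vector of signed
  minors lie in the left kernel of \<psi>(A), hence are proportional.  So
  \<psi>(\<Delta>_\<beta>1 : \<Delta>_\<beta>2 : \<Delta>_\<beta>3) = (t_1 : t_2 : t_3), and the remaining identities, which live modulo F,
  follow by applying \<psi>.

  That the kernel is (F) replaces dimension theory by derivations (characteristic 0).  Algebraicity of
  the t_j over K(p) forces a derivation killing all p_i to be zero, so the Jacobian of p has rank 3 and
  the gradients at p of any two elements of the kernel are proportional.  Let F involve X_v.  By
  minimality of F the v-th entry of its gradient does not vanish at p, so an element of the kernel
  free of X_v has all its partial derivatives in the kernel as well, and by descent on the degree it
  is zero.  Pseudo-division in the variable X_v and primality of the irreducible F (K[X] is factorial)
  then show that F divides every element of the kernel.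
*)
theory Submission
  imports Defs "Berlekamp_Zassenhaus.Unique_Factorization_Poly"
begin

subsection \<open>Multivariate polynomials\<close>

abbreviation keys where "keys \<equiv> Poly_Mapping.keys"
abbreviation lookup where "lookup \<equiv> Poly_Mapping.lookup"
abbreviation single where "single \<equiv> Poly_Mapping.single"

lemma poly_mapping_eq_sum_single: "P = (\<Sum>\<alpha>\<in>keys P. single \<alpha> (lookup P \<alpha>))"
proof (rule poly_mapping_eqI)
  fix k
  have "lookup (\<Sum>\<alpha>\<in>keys P. single \<alpha> (lookup P \<alpha>)) k
      = (\<Sum>\<alpha>\<in>keys P. if \<alpha> = k then lookup P \<alpha> else 0)"
    unfolding lookup_sum by (rule sum.cong) (auto simp: lookup_single when_def)
  also have "\<dots> = lookup P k" by (auto simp: in_keys_iff)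
  finally show "lookup P k = lookup (\<Sum>\<alpha>\<in>keys P. single \<alpha> (lookup P \<alpha>)) k" by simp
qed

text \<open>Reduces additive and bilinear identities to monomials. The zero polynomial falls under
  \<open>single\<close>, since \<open>c\<close> may be 0.\<close>

lemma poly_mapping_induct_single [case_names single add]:
  fixes P :: "'k \<Rightarrow>\<^sub>0 'b::comm_monoid_add"
  assumes "\<And>\<alpha> c. Pr (single \<alpha> c)" and "\<And>P Q. Pr P \<Longrightarrow> Pr Q \<Longrightarrow> Pr (P + Q)"
  shows "Pr P"
proof -
  have "Pr (\<Sum>\<alpha>\<in>U. single \<alpha> (lookup P \<alpha>))" if "finite U" for U
    using that
  proof (induction U)
    case empty
    show ?case using assms(1)[of undefined 0] by simp
  qed (simp add: assms)
  from this[of "keys P"] show ?thesis using poly_mapping_eq_sum_single[of P] by simp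
qed

text \<open>Supports vary from polynomial to polynomial; a common finite index set makes their sums
  comparable.\<close>

lemma sum_keys_superset:
  assumes "finite U" "keys P \<subseteq> U" "\<And>\<alpha>. f \<alpha> 0 = 0"
  shows "(\<Sum>\<alpha>\<in>keys P. f \<alpha> (lookup P \<alpha>)) = (\<Sum>\<alpha>\<in>U. f \<alpha> (lookup P \<alpha>))"
  using assms by (intro sum.mono_neutral_left) (auto simp: in_keys_iff)

lemma sum_keys_single: "f \<alpha> 0 = 0 \<Longrightarrow> (\<Sum>\<gamma>\<in>keys (single \<alpha> c). f \<gamma> (lookup (single \<alpha> c) \<gamma>)) = f \<alpha> c"
  by (cases "c = 0") auto

lemma keys_add_nat: "keys (\<alpha> + \<beta>) = keys \<alpha> \<union> keys (\<beta> :: nat \<Rightarrow>\<^sub>0 nat)"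
  by (auto simp: in_keys_iff lookup_add)

lemma prod_keys_superset:
  fixes q :: "nat \<Rightarrow> 'b::comm_monoid_mult"
  assumes "finite U" "keys \<alpha> \<subseteq> U"
  shows "(\<Prod>i\<in>keys \<alpha>. q i ^ lookup \<alpha> i) = (\<Prod>i\<in>U. q i ^ lookup \<alpha> i)"
  using assms by (intro prod.mono_neutral_left) (auto simp: in_keys_iff)

section \<open>Substitution as a ring homomorphism\<close>

definition monom_eval :: "(nat \<Rightarrow> 'b::comm_monoid_mult) \<Rightarrow> (nat \<Rightarrow>\<^sub>0 nat) \<Rightarrow> 'b" where
  "monom_eval q \<alpha> = (\<Prod>i\<in>keys \<alpha>. q i ^ lookup \<alpha> i)"

lemma monom_eval_add: "monom_eval q (\<alpha> + \<beta>) = monom_eval q \<alpha> * monom_eval q \<beta>"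
proof -
  let ?U = "keys \<alpha> \<union> keys \<beta>"
  have "monom_eval q \<gamma> = (\<Prod>i\<in>?U. q i ^ lookup \<gamma> i)" if "keys \<gamma> \<subseteq> ?U" for \<gamma>
    unfolding monom_eval_def by (rule prod_keys_superset) (use that in auto)
  from this[of \<alpha>] this[of \<beta>] this[of "\<alpha> + \<beta>"] show ?thesis
    by (simp add: keys_add_nat lookup_add power_add prod.distrib)
qed

lemma monom_eval_0 [simp]: "monom_eval q 0 = 1"
  by (simp add: monom_eval_def)

lemma monom_eval_single [simp]: "monom_eval q (single i n) = q i ^ n"
  by (cases "n = 0") (auto simp: monom_eval_def)

lemma mpoly_subst_alt: "mpoly_subst P q = (\<Sum>\<alpha>\<in>keys P. single 0 (lookup P \<alpha>) * monom_eval q \<alpha>)"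
  by (simp add: mpoly_subst_def monom_eval_def)

lemma mpoly_subst_single [simp]: "mpoly_subst (single \<alpha> c) q = single 0 c * monom_eval q \<alpha>"
  unfolding mpoly_subst_alt by (rule sum_keys_single) auto

lemma mpoly_subst_add: "mpoly_subst (P + Q) q = mpoly_subst P q + mpoly_subst Q q"
  unfolding mpoly_subst_alt by (rule setsum_keys_plus_distrib) (auto simp: single_add algebra_simps)

lemma mpoly_subst_mult: "mpoly_subst (P * Q) q = mpoly_subst P q * mpoly_subst Q q"
proof (induction P rule: poly_mapping_induct_single)
  case (single \<alpha> c)
  show ?case
  proof (induction Q rule: poly_mapping_induct_single)
    case (single \<beta> d)
    have "mpoly_subst (single \<alpha> c * single \<beta> d) q = (single 0 c * single 0 d) * monom_eval q (\<alpha> + \<beta>)"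
      by (simp add: mult_single)
    then show ?case by (simp add: monom_eval_add ac_simps)
  qed (simp add: algebra_simps mpoly_subst_add)
qed (simp add: algebra_simps mpoly_subst_add)

lemma mpoly_subst_const [simp]: "mpoly_subst (single 0 c) q = single 0 c"
  by simp

lemma mpoly_subst_mvar [simp]: "mpoly_subst (mvar i) q = q i"
  by (simp add: mvar_def)

lemma mpoly_subst_hom: "comm_ring_hom (\<lambda>P. mpoly_subst P q)"
proof
  show "mpoly_subst 0 q = 0" by (simp add: mpoly_subst_def)
  show "mpoly_subst 1 q = 1" using mpoly_subst_const[of 1 q] by (simp del: mpoly_subst_const)
qed (auto simp: mpoly_subst_add mpoly_subst_mult)

interpretation subst: comm_ring_hom "\<lambda>P. mpoly_subst P q" for q :: "nat \<Rightarrow> 'a::comm_ring_1 mpoly"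
  by (rule mpoly_subst_hom)

lemma monom_eval_mvar: "monom_eval mvar \<alpha> = (single \<alpha> 1 :: 'a::comm_ring_1 mpoly)"
proof (induction \<alpha> rule: poly_mapping_induct_single)
  case (single i n)
  have "mvar i ^ n = (single (single i n) 1 :: 'a mpoly)"
    by (induction n) (auto simp: mvar_def mult_single single_add[symmetric])
  then show ?case by simp
qed (simp add: monom_eval_add mult_single)

lemma mpoly_subst_mvars_id: "mpoly_subst P mvar = P"
  using poly_mapping_eq_sum_single[of P]
  by (simp add: mpoly_subst_alt monom_eval_mvar mult_single)

text \<open>Substituting each variable for itself gives \<open>P\<close> back, and the definition of
  substitution displays the result as sums and products of constants and variables from
  \<open>V\<close>.\<close>

lemma mpoly_induct_vars [consumes 1, case_names const var add mult]:
  fixes P :: "'a::comm_ring_1 mpoly"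
  assumes "mvars P \<subseteq> V"
    and const: "\<And>c. Pr (single 0 c)" and var: "\<And>i. i \<in> V \<Longrightarrow> Pr (mvar i)"
    and add: "\<And>P Q. Pr P \<Longrightarrow> Pr Q \<Longrightarrow> Pr (P + Q)"
    and mult: "\<And>P Q. Pr P \<Longrightarrow> Pr Q \<Longrightarrow> Pr (P * Q)"
  shows "Pr P"
proof -
  have one: "Pr 1" using const[of 1] by simp
  have zero: "Pr 0" using const[of 0] by simp
  have pow: "Pr (Q ^ n)" if "Pr Q" for Q n
    using that by (induction n) (auto intro: mult one)
  have pr: "Pr (\<Prod>i\<in>U. g i)" if "finite U" "\<And>i. i \<in> U \<Longrightarrow> Pr (g i)" for g and U :: "nat set"
    using that by (induction U) (auto intro: mult one)
  have su: "Pr (\<Sum>i\<in>U. g i)" if "finite U" "\<And>i. i \<in> U \<Longrightarrow> Pr (g i)" for g and U :: "(nat \<Rightarrow>\<^sub>0 nat) set"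
    using that by (induction U) (auto intro: add zero)
  have "Pr (mpoly_subst P mvar)"
    unfolding mpoly_subst_def
    by (intro su mult const pr pow var) (use assms(1) in \<open>auto simp: mvars_def\<close>)
  then show ?thesis by (simp add: mpoly_subst_mvars_id)
qed

lemma mvars_empty_imp_const:
  assumes "mvars P = {}"
  obtains c where "P = (single 0 c :: 'a::comm_ring_1 mpoly)"
proof -
  have "\<exists>c. P = single 0 c"
    using assms[THEN equalityD1]
  proof (induction P rule: mpoly_induct_vars)
    case (add P Q) then show ?case by (metis single_add)
  next
    case (mult P Q) then show ?case by (metis mult_single add_0)
  qed auto
  then show ?thesis using that by blast
qed

lemma mpoly_subst_compose:
  "mpoly_subst (mpoly_subst P q) r = mpoly_subst P (\<lambda>i. mpoly_subst (q i) r)"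
  using subset_UNIV
  by (induction P rule: mpoly_induct_vars)
    (auto simp: mpoly_subst_add mpoly_subst_mult)

lemma mvars_const [simp]: "mvars (single 0 c) = {}"
  by (cases "c = 0") (auto simp: mvars_def)

lemma mvars_mvar: "mvars (mvar i :: 'a::comm_ring_1 mpoly) = {i}"
  by (auto simp: mvars_def mvar_def)

lemma mvars_add: "mvars (P + Q) \<subseteq> mvars P \<union> mvars Q"
  using keys_add[of P Q] by (auto simp: mvars_def)

lemma mvars_mult: "mvars (P * Q) \<subseteq> mvars P \<union> mvars (Q :: 'a::comm_ring_1 mpoly)"
proof
  fix i assume "i \<in> mvars (P * Q)"
  then obtain \<gamma> where \<gamma>: "\<gamma> \<in> keys (P * Q)" "i \<in> keys \<gamma>" by (auto simp: mvars_def)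
  from keys_mult[of P Q] \<gamma>(1) obtain \<alpha> \<beta> where "\<gamma> = \<alpha> + \<beta>" "\<alpha> \<in> keys P" "\<beta> \<in> keys Q" by blast
  with \<gamma>(2) show "i \<in> mvars P \<union> mvars Q" by (auto simp: mvars_def keys_add_nat)
qed

lemma mvars_subst:
  fixes P :: "'a::comm_ring_1 mpoly"
  assumes "mvars P \<subseteq> V" "\<And>i. i \<in> V \<Longrightarrow> mvars (q i) \<subseteq> W"
  shows "mvars (mpoly_subst P q) \<subseteq> W"
  using assms(1)
proof (induction P rule: mpoly_induct_vars)
  case (add P Q) then show ?case using mvars_add by (fastforce simp: mpoly_subst_add)
next
  case (mult P Q) then show ?case using mvars_mult by (fastforce simp: mpoly_subst_mult)
qed (use assms(2) in auto)

lemma mpoly_subst_cong: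
  fixes P :: "'a::comm_ring_1 mpoly"
  assumes "mvars P \<subseteq> V" "\<And>i. i \<in> V \<Longrightarrow> q i = r i"
  shows "mpoly_subst P q = mpoly_subst P r"
  using assms(1)
  by (induction P rule: mpoly_induct_vars) (use assms(2) in \<open>auto simp: mpoly_subst_add mpoly_subst_mult\<close>)

section \<open>Degrees and homogeneity\<close>

lemma tdeg_add: "tdeg (\<alpha> + \<beta>) = tdeg \<alpha> + tdeg \<beta>"
proof -
  let ?U = "keys \<alpha> \<union> keys \<beta>"
  have "tdeg \<gamma> = (\<Sum>i\<in>?U. lookup \<gamma> i)" if "keys \<gamma> \<subseteq> ?U" for \<gamma>
    unfolding tdeg_def using that by (intro sum_keys_superset) auto
  from this[of \<alpha>] this[of \<beta>] this[of "\<alpha> + \<beta>"] show ?thesis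
    by (simp add: keys_add_nat lookup_add sum.distrib)
qed

lemma tdeg_single [simp]: "tdeg (single i n) = n"
  by (cases "n = 0") (auto simp: tdeg_def)

lemma homog_add: "homog n P \<Longrightarrow> homog n Q \<Longrightarrow> homog n (P + Q)"
  using keys_add[of P Q] by (auto simp: homog_def)

lemma homog_mult: "homog n P \<Longrightarrow> homog k Q \<Longrightarrow> homog (n + k) (P * (Q :: 'a::comm_ring_1 mpoly))"
  using keys_mult[of P Q] by (fastforce simp: homog_def tdeg_add)

lemma homog_one [simp]: "homog 0 (1 :: 'a::comm_ring_1 mpoly)"
  by (simp add: homog_def tdeg_def)

lemma homog_zero [simp]: "homog n 0"
  by (simp add: homog_def)

lemma homog_sum: "(\<And>i. i \<in> U \<Longrightarrow> homog n (g i)) \<Longrightarrow> homog n (sum g U)"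
  by (induction U rule: infinite_finite_induct) (auto intro: homog_add)

lemma homog_prod:
  fixes g :: "'i \<Rightarrow> 'a::comm_ring_1 mpoly"
  assumes "\<And>i. i \<in> U \<Longrightarrow> homog (n i) (g i)"
  shows "homog (sum n U) (prod g U)"
  using assms
proof (induction U rule: infinite_finite_induct)
  case (insert x F) then show ?case by (auto intro: homog_mult)
qed auto

text \<open>Each monomial contributes one factor \<open>c\<close> per unit of degree. This is what
  allows vectors that are only proportional to be compared under a homogeneous map.\<close>

lemma homog_subst_scale:
  fixes P :: "'a::comm_ring_1 mpoly"
  assumes "homog n P"
  shows "mpoly_subst P (\<lambda>i. c * q i) = c ^ n * mpoly_subst P q"
proof -
  have "monom_eval (\<lambda>i. c * q i) \<alpha> = c ^ tdeg \<alpha> * monom_eval q \<alpha>" for \<alpha>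
    by (simp add: monom_eval_def tdeg_def power_mult_distrib prod.distrib power_sum)
  with assms show ?thesis
    unfolding mpoly_subst_alt sum_distrib_left
    by (intro sum.cong) (auto simp: homog_def algebra_simps)
qed

subsection \<open>Partial derivatives and the Jacobian\<close>

text \<open>The subtraction of exponents is truncated. When variable \<open>i\<close> is absent from
  \<alpha>, the factor \<open>of_nat (lookup \<alpha> i)\<close> is 0, so the truncation does no
  harm.\<close>

definition pdiff :: "nat \<Rightarrow> 'a::comm_ring_1 mpoly \<Rightarrow> 'a mpoly" where
  "pdiff i P = (\<Sum>\<alpha>\<in>keys P. single (\<alpha> - single i 1) (of_nat (lookup \<alpha> i) * lookup P \<alpha>))"

lemma pdiff_single [simp]: "pdiff i (single \<alpha> c) = single (\<alpha> - single i 1) (of_nat (lookup \<alpha> i) * c)"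
  unfolding pdiff_def
  by (rule sum_keys_single[where f = "\<lambda>\<alpha> c. single (\<alpha> - single i 1) (of_nat (lookup \<alpha> i) * c)"]) auto

lemma pdiff_add: "pdiff i (P + Q) = pdiff i P + pdiff i Q"
  unfolding pdiff_def by (rule setsum_keys_plus_distrib) (auto simp: single_add[symmetric] algebra_simps)

lemma pdiff_0 [simp]: "pdiff i 0 = 0"
  by (simp add: pdiff_def)

lemma minus_single_add:
  assumes "lookup \<alpha> i \<noteq> (0::nat)"
  shows "\<alpha> - single i 1 + \<beta> = \<alpha> + \<beta> - single i 1"
  using assms by (intro poly_mapping_eqI) (auto simp: lookup_add lookup_minus lookup_single when_def)

lemma pdiff_mult: "pdiff i (P * Q) = pdiff i P * Q + P * pdiff i Q"
proof (induction P rule: poly_mapping_induct_single)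
  case (single \<alpha> c)
  show ?case
  proof (induction Q rule: poly_mapping_induct_single)
    case (single \<beta> d)
    have 1: "single (\<alpha> - single i 1) (of_nat (lookup \<alpha> i) * c) * single \<beta> d
        = single (\<alpha> + \<beta> - single i 1) (of_nat (lookup \<alpha> i) * c * d)"
      using minus_single_add[of \<alpha> i \<beta>] by (cases "lookup \<alpha> i = 0") (auto simp: mult_single)
    have 2: "single \<alpha> c * single (\<beta> - single i 1) (of_nat (lookup \<beta> i) * d)
        = single (\<alpha> + \<beta> - single i 1) (of_nat (lookup \<beta> i) * c * d)"
      using minus_single_add[of \<beta> i \<alpha>] by (cases "lookup \<beta> i = 0") (auto simp: mult_single algebra_simps)
    show ?case
      by (simp only: pdiff_single 1 2) (simp add: mult_single single_add[symmetric] lookup_add algebra_simps)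
  qed (simp add: algebra_simps pdiff_add)
qed (simp add: algebra_simps pdiff_add)

lemma pdiff_mvar: "pdiff i (mvar j) = (if i = j then 1 else 0)"
  by (auto simp: mvar_def lookup_single)

lemma lookup_pdiff:
  "lookup (pdiff i P) \<beta> = of_nat (lookup \<beta> i + 1) * lookup P (\<beta> + single i 1)"
proof (induction P rule: poly_mapping_induct_single)
  case (single \<alpha> c)
  show ?case
  proof (cases "lookup \<alpha> i = 0")
    case True
    then have "\<alpha> \<noteq> \<beta> + single i 1" by (auto simp: lookup_add)
    with True show ?thesis by (simp add: lookup_single when_def)
  next
    case False
    then have "\<alpha> - single i 1 = \<beta> \<longleftrightarrow> \<alpha> = \<beta> + single i 1"
      using minus_single_add[of \<alpha> i "single i 1"] by auto
    moreover have "lookup (\<beta> + single i 1) i = lookup \<beta> i + 1" by (simp add: lookup_add)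
    ultimately show ?thesis by (auto simp: lookup_single when_def)
  qed
qed (simp add: pdiff_add lookup_add algebra_simps)

text \<open>A monomial containing variable \<open>i\<close> survives because its exponent stays
  nonzero in a field of characteristic 0.\<close>

lemma pdiff_nonzero:
  fixes P :: "'a::field_char_0 mpoly"
  assumes "i \<in> mvars P"
  shows "pdiff i P \<noteq> 0"
proof -
  from assms obtain \<alpha> where \<alpha>: "\<alpha> \<in> keys P" "lookup \<alpha> i \<noteq> 0"
    by (auto simp: mvars_def in_keys_iff)
  have "\<alpha> - single i 1 + single i 1 = \<alpha>" using minus_single_add[OF \<alpha>(2)] by simp
  with \<alpha>(1) have "lookup (pdiff i P) (\<alpha> - single i 1) \<noteq> 0"
    using of_nat_neq_0[where 'a = 'a] by (simp add: lookup_pdiff in_keys_iff del: of_nat_add of_nat_Suc)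
  then show ?thesis by auto
qed

lemma keys_pdiff: "\<beta> \<in> keys (pdiff i P) \<Longrightarrow> \<beta> + single i 1 \<in> keys P"
  by (auto simp: in_keys_iff lookup_pdiff)

lemma mvars_pdiff: "mvars (pdiff i P) \<subseteq> mvars P"
  by (auto simp: mvars_def keys_add_nat dest!: keys_pdiff)

lemma homog_pdiff: "homog n P \<Longrightarrow> homog (n - 1) (pdiff i P)"
  by (auto simp: homog_def tdeg_add dest!: keys_pdiff)

lemma ptdeg_pdiff_less:
  assumes "pdiff i P \<noteq> 0"
  shows "ptdeg (pdiff i P) < ptdeg P"
proof -
  have "ptdeg (pdiff i P) \<in> tdeg ` keys (pdiff i P)"
    unfolding ptdeg_def using assms by (intro Max_in) auto
  then obtain \<beta> where \<beta>: "\<beta> \<in> keys (pdiff i P)" "ptdeg (pdiff i P) = tdeg \<beta>" by auto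
  have "tdeg (\<beta> + single i 1) \<le> ptdeg P"
    unfolding ptdeg_def by (intro Max_ge) (use keys_pdiff[OF \<beta>(1)] in auto)
  with \<beta>(2) show ?thesis by (simp add: tdeg_add)
qed

lemma pdiff_chain_rule:
  assumes "mvars G \<subseteq> {..<n}"
  shows "pdiff j (mpoly_subst G p) = (\<Sum>i<n. mpoly_subst (pdiff i G) p * pdiff j (p i))"
  using assms
proof (induction G rule: mpoly_induct_vars)
  case (var k)
  have "(\<Sum>i<n. mpoly_subst (pdiff i (mvar k)) p * pdiff j (p i)) = (\<Sum>i<n. if i = k then pdiff j (p i) else 0)"
    by (rule sum.cong) (auto simp: pdiff_mvar)
  with var show ?case by simp
next
  case (mult P Q)
  then show ?case
    by (simp add: pdiff_mult mpoly_subst_mult mpoly_subst_add algebra_simps sum.distrib sum_distrib_left)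
qed (auto simp: pdiff_add mpoly_subst_add algebra_simps sum.distrib)

text \<open>Differentiating an annihilating polynomial of least degree kills \<open>D x\<close>.\<close>

lemma derivation_zero_on_algebraic:
  fixes D :: "'b::{idom,ring_char_0} \<Rightarrow> 'b"
  assumes add: "\<And>a b. D (a + b) = D a + D b" and mult: "\<And>a b. D (a * b) = D a * b + a * D b"
    and "q \<noteq> 0" "poly q x = 0" "\<And>k. D (coeff q k) = 0"
  shows "D x = 0"
  using assms(3-)
proof (induction "degree q" arbitrary: q rule: less_induct)
  case less
  have D0: "D 0 = 0" using add[of 0 0] by simp
  have D1: "D 1 = 0" using mult[of 1 1] by simp
  have Dnat: "D (of_nat n) = 0" for n by (induction n) (auto simp: add D0 D1)
  have Dp: "D (poly r x) = poly (map_poly D r) x + poly (pderiv r) x * D x" for r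
    by (induction r) (auto simp: D0 add mult map_poly_pCons pderiv_pCons algebra_simps)
  have "map_poly D q = 0" by (intro poly_eqI) (auto simp: coeff_map_poly D0 less.prems)
  with Dp[of q] less.prems D0 have *: "poly (pderiv q) x = 0 \<or> D x = 0" by simp
  have "degree q \<noteq> 0"
  proof
    assume "degree q = 0"
    then obtain c where "q = [:c:]" by (rule degree_eq_zeroE)
    with less.prems show False by simp
  qed
  \<comment> \<open>Characteristic 0 keeps the derivative nonzero. If it vanishes at
    \<open>x\<close>, it is an annihilating polynomial of smaller degree to which the induction
    applies.\<close>
  then have "pderiv q \<noteq> 0" "degree (pderiv q) < degree q"
    by (auto simp: pderiv_eq_0_iff degree_pderiv)
  moreover have "D (coeff (pderiv q) k) = 0" for k
    by (simp add: coeff_pderiv mult Dnat less.prems del: of_nat_Suc)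
  ultimately show ?case using * less.hyps by blast
qed

text \<open>The derivation with components \<open>c\<close> kills every \<open>p i\<close>, hence
  all of K[p] by the chain rule. Each variable is algebraic over that ring, so the derivation kills
  it too, and its value there is \<open>c k\<close>. Thus the Jacobian has trivial kernel.\<close>

lemma generically_finite_jacobian:
  fixes p :: "nat \<Rightarrow> 'a::field_char_0 mpoly"
  assumes "generically_finite p"
    and zero: "\<And>i. i < 4 \<Longrightarrow> (\<Sum>j<3. c j * pdiff j (p i)) = 0"
    and "k < 3"
  shows "c k = 0"
proof -
  define D where "D P = (\<Sum>j<3. c j * pdiff j P)" for P
  have add: "D (P + Q) = D P + D Q" for P Q
    by (simp add: D_def pdiff_add algebra_simps sum.distrib)
  have mult: "D (P * Q) = D P * Q + P * D Q" for P Q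
    by (simp add: D_def pdiff_mult algebra_simps sum.distrib sum_distrib_left)
  from assms(1,3) obtain Q :: "'a mpoly poly" where Q: "\<And>k. mvars (coeff Q k) \<subseteq> {..<4}"
      "map_poly (\<lambda>c. mpoly_subst c p) Q \<noteq> 0" "poly (map_poly (\<lambda>c. mpoly_subst c p) Q) (mvar k) = 0"
    unfolding generically_finite_def by blast
  have Dp: "D (mpoly_subst G p) = 0" if "mvars G \<subseteq> {..<4}" for G
  proof -
    have "D (mpoly_subst G p) = (\<Sum>j<3. \<Sum>i<4. mpoly_subst (pdiff i G) p * (c j * pdiff j (p i)))"
      unfolding D_def pdiff_chain_rule[OF that] by (simp add: sum_distrib_left algebra_simps)
    also have "\<dots> = (\<Sum>i<4. mpoly_subst (pdiff i G) p * (\<Sum>j<3. c j * pdiff j (p i)))"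
      by (subst sum.swap) (simp add: sum_distrib_left)
    also have "\<dots> = 0" using zero by (intro sum.neutral) auto
    finally show ?thesis .
  qed
  have "D (mvar k) = 0"
    by (rule derivation_zero_on_algebraic[OF add mult Q(2,3)]) (simp add: coeff_map_poly Dp Q(1))
  also have "D (mvar k) = (\<Sum>j<3. if j = k then c j else 0)"
    unfolding D_def by (rule sum.cong) (auto simp: pdiff_mvar)
  finally show ?thesis using assms(3) by simp
qed

lemma exists_orthogonal_vector3:
  fixes a b :: "nat \<Rightarrow> 'b::idom"
  shows "\<exists>c. (\<Sum>j<3. c j * a j) = 0 \<and> (\<Sum>j<3. c j * b j) = 0 \<and> (\<exists>k<3. c k \<noteq> 0)"
proof -
  \<comment> \<open>Padding with a zero row makes the matrix square and singular, and a singular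
    matrix over a domain has a nonzero kernel vector with entries in that domain.\<close>
  define A where "A = mat 3 3 (\<lambda>(i, j). if i = 0 then a j else if i = 1 then b j else 0)"
  have A: "A \<in> carrier_mat 3 3" by (simp add: A_def)
  have "det A = (\<Sum>j<3. A $$ (2, j) * cofactor A 2 j)"
    by (rule laplace_expansion_row[OF A]) simp
  also have "\<dots> = 0" by (simp add: A_def)
  finally have "det A = 0" .
  then obtain v where v: "v \<in> carrier_vec 3" "v \<noteq> 0\<^sub>v 3" "A *\<^sub>v v = 0\<^sub>v 3"
    using det_0_iff_vec_prod_zero[OF A] by auto
  have *: "(\<Sum>j<3. A $$ (i, j) * v $ j) = 0" if "i < 3" for i
  proof -
    have "(A *\<^sub>v v) $ i = (\<Sum>j<3. A $$ (i, j) * v $ j)"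
      using that A v(1) by (simp add: scalar_prod_def lessThan_atLeast0)
    then show ?thesis using v(3) that by simp
  qed
  have "(\<Sum>j<3. v $ j * a j) = 0" using *[of 0] by (simp add: A_def mult.commute)
  moreover have "(\<Sum>j<3. v $ j * b j) = 0" using *[of 1] by (simp add: A_def mult.commute)
  moreover have "\<exists>k<3. v $ k \<noteq> 0"
  proof (rule ccontr)
    assume "\<not> ?thesis"
    then have "v = 0\<^sub>v 3" using v(1) by (intro eq_vecI) auto
    with v(2) show False by simp
  qed
  ultimately show ?thesis by (intro exI[of _ "\<lambda>j. v $ j"]) simp
qed

text \<open>The left kernel of a 4 by 3 matrix of rank three has rank one: if \<open>w\<close> were nonzero, a vector
  orthogonal to the two rows other than \<open>v\<close> and \<open>k\<close> would be orthogonal to all four.\<close>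

lemma left_kernel_vanishes:
  fixes J :: "nat \<Rightarrow> nat \<Rightarrow> 'b::idom"
  assumes inj: "\<And>c. (\<And>i. i < 4 \<Longrightarrow> (\<Sum>j<3. c j * J i j) = 0) \<Longrightarrow> (\<And>k. k < 3 \<Longrightarrow> c k = 0)"
    and u: "\<And>j. j < 3 \<Longrightarrow> (\<Sum>i<4. u i * J i j) = 0" and w: "\<And>j. j < 3 \<Longrightarrow> (\<Sum>i<4. w i * J i j) = 0"
    and "v < 4" "u v \<noteq> 0" "w v = 0" "k < 4"
  shows "w k = 0"
proof (rule ccontr)
  assume wk: "w k \<noteq> 0"
  with assms have "k \<noteq> v" by auto
  have "card ({..<4} - {v, k}) = 2"
    using \<open>k \<noteq> v\<close> \<open>k < 4\<close> \<open>v < 4\<close> by (subst card_Diff_subset) auto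
  then obtain a b where ab: "{..<4} - {v, k} = {a, b}" by (auto simp: card_2_iff)
  obtain c where c: "(\<Sum>j<3. c j * J a j) = 0" "(\<Sum>j<3. c j * J b j) = 0" "\<exists>k<3. c k \<noteq> 0"
  proof -
    obtain c where "(\<Sum>j<3. c j * J a j) = 0 \<and> (\<Sum>j<3. c j * J b j) = 0 \<and> (\<exists>k<3. c k \<noteq> 0)"
      using exists_orthogonal_vector3[of "J a" "J b"] ..
    then show ?thesis using that[of c] by simp
  qed
  have eq: "(\<Sum>i<4. x i * (\<Sum>j<3. c j * J i j)) = 0" if "\<And>j. j < 3 \<Longrightarrow> (\<Sum>i<4. x i * J i j) = 0" for x
  proof -
    have "(\<Sum>i<4. x i * (\<Sum>j<3. c j * J i j)) = (\<Sum>j<3. \<Sum>i<4. c j * (x i * J i j))"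
      unfolding sum_distrib_left by (subst sum.swap) (simp add: algebra_simps)
    also have "\<dots> = (\<Sum>j<3. c j * (\<Sum>i<4. x i * J i j))" by (simp add: sum_distrib_left)
    also have "\<dots> = 0" using that by (intro sum.neutral) auto
    finally show ?thesis .
  qed
  have others: "(\<Sum>j<3. c j * J i j) = 0" if "i < 4" "i \<noteq> v" "i \<noteq> k" for i
  proof -
    from that have "i \<in> {a, b}" unfolding ab[symmetric] by simp
    with c(1,2) show ?thesis by auto
  qed
  \<comment> \<open>Row \<open>v\<close> drops out because \<open>w v = 0\<close>, the other two
    rows because \<open>c\<close> is orthogonal to them. Only row \<open>k\<close> remains, and
    \<open>w k\<close> is nonzero.\<close>
  have "(\<Sum>i<4. w i * (\<Sum>j<3. c j * J i j)) = (\<Sum>i\<in>{k}. w i * (\<Sum>j<3. c j * J i j))"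
  proof (rule sum.mono_neutral_right)
    show "\<forall>i\<in>{..<4} - {k}. w i * (\<Sum>j<3. c j * J i j) = 0"
    proof
      fix i assume "i \<in> {..<4} - {k}"
      then show "w i * (\<Sum>j<3. c j * J i j) = 0" using \<open>w v = 0\<close> others[of i] by (cases "i = v") simp_all
    qed
  qed (use \<open>k < 4\<close> in auto)
  with eq[of w, OF w] wk have k0: "(\<Sum>j<3. c j * J k j) = 0" by simp
  \<comment> \<open>With row \<open>k\<close> now orthogonal to \<open>c\<close> as well, the
    relation \<open>u\<close> isolates row \<open>v\<close>.\<close>
  have "(\<Sum>i<4. u i * (\<Sum>j<3. c j * J i j)) = (\<Sum>i\<in>{v}. u i * (\<Sum>j<3. c j * J i j))"
  proof (rule sum.mono_neutral_right)
    show "\<forall>i\<in>{..<4} - {v}. u i * (\<Sum>j<3. c j * J i j) = 0"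
    proof
      fix i assume "i \<in> {..<4} - {v}"
      then show "u i * (\<Sum>j<3. c j * J i j) = 0" using k0 others[of i] by (cases "i = k") simp_all
    qed
  qed (use \<open>v < 4\<close> in auto)
  with eq[of u, OF u] \<open>u v \<noteq> 0\<close> have v0: "(\<Sum>j<3. c j * J v j) = 0" by simp
  have all: "(\<Sum>j<3. c j * J i j) = 0" if "i < 4" for i
    by (cases "i = v"; cases "i = k") (simp_all add: k0 v0 others that)
  from c(3) obtain l where "l < 3" "c l \<noteq> 0" by blast
  with inj[of c l, OF all] show False by simp
qed

subsection \<open>The kernel of the parametrization\<close>

text \<open>Up to nonzero constants of the coefficient ring, \<open>f\<close> and \<open>g\<close>
  are both multiples of a kernel element \<open>h\<close> of least degree. As \<chi> is injective on
  constants, \<open>h\<close> is not constant; primality of \<open>f\<close> then gives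
  \<open>f dvd h\<close>, and from this \<open>f dvd g\<close>.\<close>

lemma irreducible_dvd_of_hom_zero:
  fixes f g :: "'b::ufd poly" and \<chi> :: "'b poly \<Rightarrow> 'c::idom"
  assumes "comm_ring_hom \<chi>" and irr: "irreducible f" and f0: "\<chi> f = 0"
    and inj: "\<And>b. \<chi> [:b:] = 0 \<Longrightarrow> b = 0" and g0: "\<chi> g = 0"
  shows "f dvd g"
proof -
  interpret comm_ring_hom \<chi> by fact
  have prime: "prime_elem f" using irr by simp
  have "f \<noteq> 0" using irr by auto
  text \<open>Among the nonzero elements of the kernel, \<open>h\<close> has least degree, so pseudo-division by it is exact.\<close>
  define Z where "Z = {h. h \<noteq> 0 \<and> \<chi> h = 0}"
  define h where "h = arg_min degree (\<lambda>h. h \<in> Z)"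
  have hZ: "h \<in> Z" and min: "\<And>r. r \<in> Z \<Longrightarrow> degree h \<le> degree r"
    using arg_min_nat_lemma[of "\<lambda>h. h \<in> Z" f degree] \<open>f \<noteq> 0\<close> f0
    by (auto simp: h_def Z_def)
  have div: "\<exists>b q. b \<noteq> 0 \<and> [:b:] * r = h * q" if "\<chi> r = 0" for r
  proof -
    obtain q s where qs: "pseudo_divmod r h = (q, s)" by (cases "pseudo_divmod r h")
    let ?b = "lead_coeff h ^ (Suc (degree r) - degree h)"
    have "h \<noteq> 0" using hZ by (simp add: Z_def)
    note pd = pseudo_divmod[OF this qs]
    have "s = [:?b:] * r - h * q" using pd(1) by simp
    then have "\<chi> s = \<chi> [:?b:] * \<chi> r - \<chi> h * \<chi> q" by (simp only: hom_minus hom_mult)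
    then have "\<chi> s = 0" using hZ that by (simp add: Z_def)
    \<comment> \<open>The remainder is in the kernel, and unless zero it would have smaller degree
      than \<open>h\<close>.\<close>
    then have "s = 0" using pd(2) min[of s] by (fastforce simp: Z_def)
    with pd(1) have "[:?b:] * r = h * q" by simp
    moreover have "?b \<noteq> 0" using \<open>h \<noteq> 0\<close> by simp
    ultimately show ?thesis by blast
  qed
  have deg: "degree h \<noteq> 0"
  proof
    assume "degree h = 0"
    then obtain b where "h = [:b:]" by (rule degree_eq_zeroE)
    with hZ inj[of b] show False by (auto simp: Z_def)
  qed
  obtain b q where bq: "b \<noteq> 0" "[:b:] * f = h * q" using div[OF f0] by blast
  then have "f dvd h * q" by (metis dvd_triv_right)
  then have "f dvd h"
  proof (rule prime_elem_dvd_multD[OF prime, THEN disjE])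
    \<comment> \<open>Cancelling \<open>f\<close> would exhibit the nonzero constant
      \<open>b\<close> as a multiple of the nonconstant \<open>h\<close>.\<close>
    assume "f dvd q"
    then obtain q' where "q = f * q'" by blast
    with bq(2) have "f * [:b:] = f * (h * q')" by (simp add: ac_simps)
    with \<open>f \<noteq> 0\<close> have "[:b:] = h * q'" by (metis mult_cancel_left)
    then have "degree (h * q') = 0" "h * q' \<noteq> 0" using bq(1) by (metis degree_pCons_0, metis pCons_eq_0_iff)
    with deg show ?thesis by (simp add: degree_mult_eq)
  qed
  obtain b' q' where bq': "b' \<noteq> 0" "[:b':] * g = h * q'" using div[OF g0] by blast
  with \<open>f dvd h\<close> have "f dvd [:b':] * g" by simp
  then show ?thesis
  proof (rule prime_elem_dvd_multD[OF prime, THEN disjE])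
    \<comment> \<open>Then \<open>f\<close> would be a constant in the kernel, hence zero.\<close>
    assume "f dvd [:b':]"
    then obtain r where "[:b':] = f * r" by blast
    then have "f * r \<noteq> 0" "degree (f * r) = 0" using bq'(1) by (metis pCons_eq_0_iff, metis degree_pCons_0)
    then have "degree f = 0" by (auto simp: degree_mult_eq)
    then obtain c where "f = [:c:]" by (rule degree_eq_zeroE)
    with f0 inj[of c] \<open>f \<noteq> 0\<close> show ?thesis by simp
  qed
qed

section \<open>Multivariate polynomials as iterated univariate polynomials\<close>

definition adjoin :: "('b::comm_ring_1 \<Rightarrow> 'a::comm_ring_1 mpoly) \<Rightarrow> nat \<Rightarrow> 'b poly \<Rightarrow> 'a mpoly" where
  "adjoin h i f = poly (map_poly h f) (mvar i)"

text \<open>A ring isomorphism onto the polynomials in the variables \<open>V\<close>. Iterating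
  \<open>adjoin\<close> from the constants makes the unique factorization of nested univariate
  polynomial rings available.\<close>

definition embeds_onto_vars :: "('b::comm_ring_1 \<Rightarrow> 'a::comm_ring_1 mpoly) \<Rightarrow> nat set \<Rightarrow> bool" where
  "embeds_onto_vars h V \<longleftrightarrow> comm_ring_hom h \<and> (\<forall>b. h b = 0 \<longrightarrow> b = 0) \<and> range h = {P. mvars P \<subseteq> V}"

lemma adjoin_pCons:
  assumes "comm_ring_hom h"
  shows "adjoin h i (pCons b f) = h b + mvar i * adjoin h i f"
proof -
  interpret comm_ring_hom h by fact
  show ?thesis by (simp add: adjoin_def map_poly_pCons_hom)
qed

lemma adjoin_0 [simp]: "adjoin h i 0 = 0"
  by (simp add: adjoin_def)

lemma adjoin_const: "comm_ring_hom h \<Longrightarrow> adjoin h i [:b:] = h b"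
  by (simp add: adjoin_pCons)

lemma lookup_mult_mvar_pow:
  "lookup (P * mvar i ^ n) \<alpha> = (if n \<le> lookup \<alpha> i then lookup P (\<alpha> - single i n) else 0)"
  for P :: "'a::comm_ring_1 mpoly"
proof -
  have *: "mvar i ^ n = (single (single i n) 1 :: 'a mpoly)"
    using monom_eval_mvar[of "single i n"] by simp
  show ?thesis
  proof (induction P rule: poly_mapping_induct_single)
    case (single \<beta> c)
    have "\<beta> + single i n = \<alpha> \<longleftrightarrow> n \<le> lookup \<alpha> i \<and> \<beta> = \<alpha> - single i n"
    proof
      assume r: "n \<le> lookup \<alpha> i \<and> \<beta> = \<alpha> - single i n"
      show "\<beta> + single i n = \<alpha>"
        using r by (intro poly_mapping_eqI) (auto simp: lookup_add lookup_minus lookup_single when_def)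
    qed (auto simp: lookup_add)
    then show ?case by (auto simp: * mult_single lookup_single when_def)
  qed (simp add: algebra_simps lookup_add)
qed

text \<open>Since \<open>i\<close> is outside \<open>V\<close>, the images of the coefficients are
  free of variable \<open>i\<close>, so distinct powers of that variable cannot cancel each other.
  Surjectivity is by induction on the construction of a polynomial.\<close>

lemma embeds_onto_vars_adjoin:
  fixes h :: "'b::comm_ring_1 \<Rightarrow> 'a::comm_ring_1 mpoly"
  assumes "embeds_onto_vars h V" "i \<notin> V"
  shows "embeds_onto_vars (adjoin h i) (insert i V)"
proof -
  interpret h: comm_ring_hom h using assms(1) by (simp add: embeds_onto_vars_def)
  have inj: "h b = 0 \<Longrightarrow> b = 0" for b using assms(1) by (simp add: embeds_onto_vars_def)
  have ran: "range h = {P. mvars P \<subseteq> V}" using assms(1) by (simp add: embeds_onto_vars_def)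
  have hom: "comm_ring_hom (adjoin h i)"
  proof -
    interpret map_poly_comm_ring_hom h ..
    show ?thesis by unfold_locales (simp_all add: adjoin_def hom_add hom_mult)
  qed
  interpret adj: comm_ring_hom "adjoin h i" by fact
  have mv: "mvars (h b) \<subseteq> V" for b using ran by auto
  have zero: "f = 0" if f: "adjoin h i f = 0" for f
  proof (rule poly_eqI)
    fix n
    have "lookup (h (coeff f n)) \<alpha> = 0" for \<alpha>
    proof (cases "lookup \<alpha> i = 0")
      case False
      then have "i \<in> keys \<alpha>" by (simp add: in_keys_iff)
      with mv[of "coeff f n"] \<open>i \<notin> V\<close> have "\<alpha> \<notin> keys (h (coeff f n))"
        unfolding mvars_def by blast
      then show ?thesis by (simp add: in_keys_iff)
    next
      \<comment> \<open>The coefficient at \<open>?\<beta>\<close> sees only the term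
        \<open>k = n\<close>: for smaller \<open>k\<close> a power of variable \<open>i\<close>
        would be left over for the coefficient, for larger \<open>k\<close> the exponent in
        \<open>?\<beta>\<close> is too small.\<close>
      case True
      let ?\<beta> = "\<alpha> + single i n"
      have "lookup (h (coeff f k) * mvar i ^ k) ?\<beta> = (if k = n then lookup (h (coeff f n)) \<alpha> else 0)" for k
      proof -
        have "lookup (h (coeff f k)) (?\<beta> - single i k) = 0" if "k < n"
        proof -
          have "i \<in> keys (?\<beta> - single i k)" using that by (simp add: in_keys_iff lookup_minus lookup_add)
          with mv[of "coeff f k"] \<open>i \<notin> V\<close> have "?\<beta> - single i k \<notin> keys (h (coeff f k))"
            unfolding mvars_def by blast
          then show ?thesis by (simp add: in_keys_iff)
        qed
        with True show ?thesis by (auto simp: lookup_mult_mvar_pow lookup_add)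
      qed
      then have "lookup (adjoin h i f) ?\<beta> = (\<Sum>k\<le>degree f. if k = n then lookup (h (coeff f n)) \<alpha> else 0)"
        by (simp add: adjoin_def h.poly_map_poly_eval_poly eval_poly_as_sum lookup_sum mult.commute)
      also have "\<dots> = lookup (h (coeff f n)) \<alpha>"
        by (cases "n \<le> degree f") (auto simp: coeff_eq_0)
      finally show ?thesis using f by simp
    qed
    then have "h (coeff f n) = 0" by (intro poly_mapping_eqI) simp
    then show "coeff f n = coeff 0 n" using inj by simp
  qed
  have "mvars (adjoin h i f) \<subseteq> insert i V" for f
  proof (induction f)
    case (pCons a f)
    have "adjoin h i (pCons a f) = h a + mvar i * adjoin h i f"
      by (rule adjoin_pCons) unfold_locales
    with pCons mv[of a] mvars_add[of "h a" "mvar i * adjoin h i f"] mvars_mult[of "mvar i" "adjoin h i f"]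
    show ?case by (auto simp: mvars_mvar)
  qed (simp add: adjoin_def mvars_def)
  moreover have "P \<in> range (adjoin h i)" if "mvars P \<subseteq> insert i V" for P
    using that
  proof (induction P rule: mpoly_induct_vars)
    case (const c)
    have "single 0 c \<in> range h" using ran by simp
    then show ?case using adjoin_const[OF h.comm_ring_hom_axioms, of i] by (metis rangeE rangeI)
  next
    case (var j)
    show ?case
    proof (cases "j = i")
      case True
      have "adjoin h i [:0, 1:] = mvar i" 
        by (simp add: adjoin_pCons h.comm_ring_hom_axioms)
      with True show ?thesis by (metis rangeI)
    next
      case False
      with var have "mvar j \<in> range h" using ran by (simp add: mvars_mvar)
      then show ?thesis using adjoin_const[OF h.comm_ring_hom_axioms, of i] by (metis rangeE rangeI)
    qed
  next
    case (add P Q)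
    then obtain f g where "P = adjoin h i f" "Q = adjoin h i g" by blast
    then have "P + Q = adjoin h i (f + g)" by (simp add: adj.hom_add)
    then show ?case by blast
  next
    case (mult P Q)
    then obtain f g where "P = adjoin h i f" "Q = adjoin h i g" by blast
    then have "P * Q = adjoin h i (f * g)" by (simp add: adj.hom_mult)
    then show ?case by blast
  qed
  ultimately show ?thesis using hom zero unfolding embeds_onto_vars_def by blast
qed

lemma embeds_onto_vars_const: "embeds_onto_vars (single 0 :: 'a::comm_ring_1 \<Rightarrow> 'a mpoly) {}"
proof -
  have "comm_ring_hom (single 0 :: 'a \<Rightarrow> 'a mpoly)"
    by unfold_locales (auto simp: single_add mult_single)
  moreover have "P \<in> range (single 0)" if "mvars P = {}" for P :: "'a mpoly"
    using mvars_empty_imp_const[OF that] by blast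
  moreover have "c = 0" if "single 0 c = (0 :: 'a mpoly)" for c
    using that by (metis lookup_single_eq lookup_zero)
  ultimately show ?thesis unfolding embeds_onto_vars_def by auto
qed

text \<open>Factorizations are carried over by \<open>h\<close>. The delicate point is units: an
  inverse of \<open>h a\<close> might a priori involve variables outside \<open>V\<close>.\<close>

lemma irreducible_embeds_onto_vars:
  fixes h :: "'b::idom \<Rightarrow> 'a::idom mpoly"
  assumes "embeds_onto_vars h V" "irreducible (h f)"
  shows "irreducible f"
proof -
  interpret h: comm_ring_hom h using assms(1) by (simp add: embeds_onto_vars_def)
  have inj: "h b = 0 \<Longrightarrow> b = 0" for b using assms(1) by (simp add: embeds_onto_vars_def)
  have ran: "range h = {P. mvars P \<subseteq> V}" using assms(1) by (simp add: embeds_onto_vars_def)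
  have unit: "a dvd 1" if "h a dvd 1" for a
  proof -
    from that obtain U where U: "1 = h a * U" by blast
    text \<open>Setting the variables outside \<open>V\<close> to zero is a retraction onto the range of \<open>h\<close>.\<close>
    define \<rho> where "\<rho> P = mpoly_subst P (\<lambda>i. if i \<in> V then mvar i else 0)" for P :: "'a mpoly"
    have "\<rho> (h a) = mpoly_subst (h a) mvar"
      unfolding \<rho>_def by (rule mpoly_subst_cong[of _ V]) (use ran in auto)
    then have "\<rho> (h a) = h a" by (simp add: mpoly_subst_mvars_id)
    with U have "1 = h a * \<rho> U" by (metis \<rho>_def mpoly_subst_mult subst.hom_one)
    moreover have "mvars (\<rho> U) \<subseteq> V"
      unfolding \<rho>_def by (rule mvars_subst[of _ UNIV]) (auto simp: mvars_mvar, simp add: mvars_def)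
    then have "\<rho> U \<in> range h" using ran by simp
    ultimately obtain b where "1 = h a * h b" by auto
    then have "h (a * b - 1) = 0" by (simp add: hom_distribs)
    then have "1 = a * b" using inj[of "a * b - 1"] by simp
    then show ?thesis by (rule dvdI)
  qed
  show ?thesis
  proof (rule irreducibleI)
    show "f \<noteq> 0" using assms(2) by auto
    show "\<not> f dvd 1" using assms(2) h.hom_dvd_1 by (auto simp: irreducible_def)
    fix a b assume "f = a * b"
    then have "h f = h a * h b" by (simp add: hom_distribs)
    with assms(2) have "h a dvd 1 \<or> h b dvd 1" by (auto dest: irreducibleD)
    then show "a dvd 1 \<or> b dvd 1" using unit by blast
  qed
qed

text \<open>Distinctness is phrased as the side conditions met when adjoining \<open>a\<close>,
  \<open>b\<close> and \<open>c\<close> in turn.\<close>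

lemma four_minus_one:
  assumes "v < (4::nat)"
  obtains a b c where "{..<4} - {v} = {a, b, c}" "a \<notin> {}" "b \<notin> {a}" "c \<notin> {b, a}"
proof -
  have "card ({..<4} - {v}) = 3" using assms by simp
  then obtain a b c where "{..<4} - {v} = {a, b, c}" "a \<noteq> b" "b \<noteq> c" "a \<noteq> c" by (auto simp: card_3_iff)
  then show ?thesis using that by auto
qed

text \<open>Adjoining variable \<open>v\<close> last makes the polynomials free of it the
  coefficient ring, so \<open>inj\<close> becomes injectivity on constants of a univariate
  polynomial ring.\<close>

lemma irreducible_generates_kernel:
  fixes F G :: "'a::field_char_0 mpoly"
  assumes "irreducible F" "mvars F \<subseteq> {..<4}" "mvars G \<subseteq> {..<4}" "v < 4"
    and "mpoly_subst F p = 0" "mpoly_subst G p = 0"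
    and inj: "\<And>H. mvars H \<subseteq> {..<4} - {v} \<Longrightarrow> mpoly_subst H p = 0 \<Longrightarrow> H = 0"
  shows "F dvd G"
proof -
  obtain a b c where abc: "{..<4} - {v} = {a, b, c}" "a \<notin> {}" "b \<notin> {a}" "c \<notin> {b, a}"
    using four_minus_one[OF \<open>v < 4\<close>] by blast
  define h where "h = adjoin (adjoin (adjoin (single 0 :: 'a \<Rightarrow> 'a mpoly) a) b) c"
  have "embeds_onto_vars h {c, b, a}"
    unfolding h_def by (intro embeds_onto_vars_adjoin embeds_onto_vars_const abc)
  then have h: "embeds_onto_vars h ({..<4} - {v})" using abc(1) by (simp add: insert_commute)
  have "insert v ({..<4} - {v}) = {..<4}" using \<open>v < 4\<close> by auto
  with embeds_onto_vars_adjoin[OF h, of v] have h': "embeds_onto_vars (adjoin h v) {..<4}" by simp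
  interpret h: comm_ring_hom h using h by (simp add: embeds_onto_vars_def)
  interpret h': comm_ring_hom "adjoin h v" using h' by (simp add: embeds_onto_vars_def)
  from h' assms(2,3) obtain f g where fg: "F = adjoin h v f" "G = adjoin h v g"
    unfolding embeds_onto_vars_def by (metis (no_types, lifting) mem_Collect_eq rangeE)
  have "f dvd g"
  proof (rule irreducible_dvd_of_hom_zero)
    show "comm_ring_hom (\<lambda>f. mpoly_subst (adjoin h v f) p)"
      by unfold_locales (simp_all add: hom_distribs)
    show "irreducible f" using irreducible_embeds_onto_vars[OF h'] assms(1) fg by simp
    show "mpoly_subst (adjoin h v f) p = 0" "mpoly_subst (adjoin h v g) p = 0" using assms fg by auto
    fix b assume "mpoly_subst (adjoin h v [:b:]) p = 0"
    then have "mpoly_subst (h b) p = 0" by (simp add: adjoin_const h.comm_ring_hom_axioms)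
    moreover have "mvars (h b) \<subseteq> {..<4} - {v}" using h by (auto simp: embeds_onto_vars_def)
    ultimately have "h b = 0" using inj by blast
    with h show "b = 0" by (simp add: embeds_onto_vars_def)
  qed
  then show ?thesis using fg h'.hom_dvd by simp
qed

text \<open>Congruences modulo \<open>F\<close> can thereby be checked after substituting
  \<open>p\<close>, in a polynomial ring without zero divisors.\<close>

lemma implicit_eq_dvd_iff:
  fixes p :: "nat \<Rightarrow> 'a::field_char_0 mpoly"
  assumes "generically_finite p" "implicit_eq p F" "mvars G \<subseteq> {..<4}"
  shows "F dvd G \<longleftrightarrow> mpoly_subst G p = 0"
proof
  assume "F dvd G"
  with assms(2) show "mpoly_subst G p = 0"
    by (auto simp: implicit_eq_def mpoly_subst_mult)
next
  assume G0: "mpoly_subst G p = 0"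
  from assms(2) obtain n where F: "mvars F \<subseteq> {..<4}" "homog n F" "irreducible F" "mpoly_subst F p = 0"
    and min: "\<And>G. G \<noteq> 0 \<Longrightarrow> mvars G \<subseteq> {..<4} \<Longrightarrow> \<exists>n. homog n G \<Longrightarrow> mpoly_subst G p = 0 \<Longrightarrow> ptdeg F \<le> ptdeg G"
    unfolding implicit_eq_def by blast
  have nonconst: "mvars H \<noteq> {}" if "H \<noteq> 0" "mpoly_subst H p = 0" for H
    using that mvars_empty_imp_const[of H] by fastforce
  obtain v where v: "v \<in> mvars F" using nonconst[of F] F by fastforce
  then have "v < 4" using F(1) by auto
  \<comment> \<open>Otherwise \<open>pdiff v F\<close>, nonzero and homogeneous of smaller degree,
    would contradict the minimality of \<open>F\<close>.\<close>
  have Fv: "mpoly_subst (pdiff v F) p \<noteq> 0"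
    using min[of "pdiff v F"] pdiff_nonzero[OF v] mvars_pdiff[of v F] homog_pdiff[OF F(2), of v]
      ptdeg_pdiff_less[of v F] F(1) by fastforce
  have tangent: "(\<Sum>i<4. mpoly_subst (pdiff i H) p * pdiff j (p i)) = 0"
    if "mvars H \<subseteq> {..<4}" "mpoly_subst H p = 0" for H j
    using pdiff_chain_rule[OF that(1), of j p] that(2) by simp
  have "H = 0" if "mvars H \<subseteq> {..<4} - {v}" "mpoly_subst H p = 0" for H
    using that
  proof (induction "ptdeg H" arbitrary: H rule: less_induct)
    case less
    show ?case
    proof (rule ccontr)
      assume "H \<noteq> 0"
      with nonconst less.prems obtain i where i: "i \<in> mvars H" by blast
      have Hv: "pdiff v H = 0"
      proof (rule ccontr)
        assume "pdiff v H \<noteq> 0"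
        then obtain \<beta> where "\<beta> \<in> keys (pdiff v H)" by fastforce
        from keys_pdiff[OF this] have "v \<in> mvars H"
          unfolding mvars_def by (auto intro!: bexI simp: keys_add_nat)
        with less.prems(1) show False by auto
      qed
      \<comment> \<open>The gradients of \<open>F\<close> and \<open>H\<close> at \<open>p\<close>
        both lie in the left kernel of the Jacobian. The \<open>v\<close>-th entry is nonzero for
        \<open>F\<close> and zero for \<open>H\<close>, so the whole gradient of \<open>H\<close>
        vanishes at \<open>p\<close>.\<close>
      have "mpoly_subst (pdiff i H) p = 0"
      proof (rule left_kernel_vanishes[where J = "\<lambda>i j. pdiff j (p i)" and u = "\<lambda>i. mpoly_subst (pdiff i F) p"
            and w = "\<lambda>i. mpoly_subst (pdiff i H) p" and v = v and k = i])
        show "(\<Sum>i<4. mpoly_subst (pdiff i F) p * pdiff j (p i)) = 0" for j by (rule tangent[OF F(1,4)])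
        show "(\<Sum>i<4. mpoly_subst (pdiff i H) p * pdiff j (p i)) = 0" for j
          by (rule tangent) (use less.prems in auto)
        show "i < 4" using i less.prems(1) by auto
        show "c k = 0" if "\<And>i. i < 4 \<Longrightarrow> (\<Sum>j<3. c j * pdiff j (p i)) = 0" "k < 3" for c k
          by (rule generically_finite_jacobian[OF assms(1) that])
      qed (use Fv Hv \<open>v < 4\<close> in auto)
      \<comment> \<open>The derivative lies in the kernel, is free of variable \<open>v\<close> and
        has smaller degree, so it would be zero although \<open>i\<close> occurs in
        \<open>H\<close>.\<close>
      with less.hyps[of "pdiff i H"] less.prems(1) mvars_pdiff[of i H] pdiff_nonzero[OF i] ptdeg_pdiff_less[of i H]
      show False by blast
    qed
  qed
  with F assms(3) G0 \<open>v < 4\<close> show "F dvd G" by (intro irreducible_generates_kernel[of F G v p])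
qed

subsection \<open>Minors\<close>

text \<open>Indexing through \<open>insert_index\<close>, which skips \<open>k\<close>, matches
  \<open>mat_delete\<close> and hence cofactors.\<close>

definition row_delete :: "'b mat \<Rightarrow> nat \<Rightarrow> 'b mat" where
  "row_delete N k = mat (dim_row N - 1) (dim_col N) (\<lambda>(i, j). N $$ (insert_index k i, j))"

lemma pick_lessThan: "i < n \<Longrightarrow> pick {..<n} i = i"
proof -
  assume "i < n"
  then have "{a \<in> {..<n}. a < i} = {..<i}" by auto
  with pick_card_in_set[of i "{..<n}"] \<open>i < n\<close> show ?thesis by simp
qed

text \<open>\<open>pick\<close> is determined by counting smaller members: exactly \<open>i\<close>
  surviving indices lie below \<open>insert_index k i\<close>.\<close>

lemma pick_lessThan_diff:
  assumes "k < n" "i < n - 1"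
  shows "pick ({..<n} - {k}) i = insert_index k i"
proof -
  let ?x = "insert_index k i"
  have "?x \<in> {..<n} - {k}" using assms by (auto simp: insert_index_def)
  from pick_card_in_set[OF this] have "pick ({..<n} - {k}) (card {a \<in> {..<n} - {k}. a < ?x}) = ?x" .
  moreover have "card {a \<in> {..<n} - {k}. a < ?x} = i"
  proof (cases "i < k")
    case True
    then have "{a \<in> {..<n} - {k}. a < ?x} = {..<i}" using assms by (auto simp: insert_index_def)
    then show ?thesis by simp
  next
    case False
    then have "{a \<in> {..<n} - {k}. a < ?x} = {..<Suc i} - {k}" using assms by (auto simp: insert_index_def)
    then show ?thesis using False by simp
  qed
  ultimately show ?thesis by simp
qed

lemma submatrix_row_delete:
  assumes "k < dim_row A"
  shows "submatrix A ({..<dim_row A} - {k}) {..<dim_col A} = row_delete A k"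
proof -
  have "{i. i < dim_row A \<and> i \<in> {..<dim_row A} - {k}} = {..<dim_row A} - {k}"
    "{j. j < dim_col A \<and> j \<in> {..<dim_col A}} = {..<dim_col A}" by auto
  then have c: "card {i. i < dim_row A \<and> i \<in> {..<dim_row A} - {k}} = dim_row A - 1"
    "card {j. j < dim_col A \<and> j \<in> {..<dim_col A}} = dim_col A" using assms by auto
  show ?thesis
    unfolding submatrix_def row_delete_def c
    by (rule eq_matI) (use assms in \<open>auto simp: pick_lessThan pick_lessThan_diff\<close>)
qed

text \<open>For \<open>C = (N | e\<^sub>j)\<close> the row vector \<open>x C\<close> is \<open>x\<^sub>j\<close> times the last unit vector; multiplying it by the
  adjugate of \<open>C\<close> gives \<open>det C\<close> times \<open>x\<close>.\<close>

lemma left_kernel_proportional_minors: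
  fixes N :: "'b::comm_ring_1 mat"
  assumes N: "N \<in> carrier_mat (Suc e) e"
    and ker: "\<And>c. c < e \<Longrightarrow> (\<Sum>r<Suc e. x r * N $$ (r, c)) = 0"
    and ij: "i < Suc e" "j < Suc e"
  shows "x i * ((-1) ^ (j + 1) * det (row_delete N j)) = x j * ((-1) ^ (i + 1) * det (row_delete N i))"
proof -
  define C where "C = mat (Suc e) (Suc e) (\<lambda>(r, c). if c < e then N $$ (r, c) else if r = j then 1 else 0)"
  have C: "C \<in> carrier_mat (Suc e) (Suc e)" by (simp add: C_def)
  have del: "mat_delete C k e = row_delete N k" if "k < Suc e" for k
    by (rule eq_matI) (use N that in \<open>auto simp: mat_delete_def row_delete_def C_def insert_index_def\<close>)
  have cof: "cofactor C k e = (-1) ^ (k + e) * det (row_delete N k)" if "k < Suc e" for k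
    using del[OF that] by (simp add: cofactor_def)
  have "det C = (\<Sum>r<Suc e. C $$ (r, e) * cofactor C r e)"
    by (rule laplace_expansion_column[OF C]) simp
  also have "\<dots> = (\<Sum>r<Suc e. if r = j then cofactor C r e else 0)"
    by (rule sum.cong) (auto simp: C_def)
  also have "\<dots> = cofactor C j e" using ij by simp
  finally have detC: "det C = cofactor C j e" .
  have adj: "(\<Sum>c<Suc e. C $$ (r, c) * cofactor C i c) = (if r = i then det C else 0)" if "r < Suc e" for r
  proof -
    have "(\<Sum>c<Suc e. C $$ (r, c) * cofactor C i c) = (C * adj_mat C) $$ (r, i)"
      using that ij C by (simp add: adj_mat_def scalar_prod_def lessThan_atLeast0)
    also have "\<dots> = (if r = i then det C else 0)" using adj_mat(2)[OF C] that ij by simp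
    finally show ?thesis .
  qed
  have "x i * det C = (\<Sum>r<Suc e. if r = i then x r * det C else 0)" using ij by simp
  also have "\<dots> = (\<Sum>r<Suc e. x r * (\<Sum>c<Suc e. C $$ (r, c) * cofactor C i c))"
    by (rule sum.cong) (auto simp del: sum.lessThan_Suc simp: adj)
  also have "\<dots> = (\<Sum>c<Suc e. \<Sum>r<Suc e. x r * C $$ (r, c) * cofactor C i c)"
    unfolding sum_distrib_left by (subst sum.swap) (simp only: mult.assoc)
  also have "\<dots> = (\<Sum>c<Suc e. (\<Sum>r<Suc e. x r * C $$ (r, c)) * cofactor C i c)"
    by (simp only: sum_distrib_right)
  \<comment> \<open>The columns of \<open>N\<close> contribute nothing by \<open>ker\<close>; the
    appended unit column picks out \<open>x j\<close>.\<close>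
  also have "\<dots> = (\<Sum>c<Suc e. if c = e then x j * cofactor C i c else 0)"
  proof (rule sum.cong[OF refl])
    fix c assume c: "c \<in> {..<Suc e}"
    show "(\<Sum>r<Suc e. x r * C $$ (r, c)) * cofactor C i c = (if c = e then x j * cofactor C i c else 0)"
    proof (cases "c = e")
      case True
      have "(\<Sum>r<Suc e. x r * C $$ (r, c)) = (\<Sum>r<Suc e. if r = j then x r else 0)"
        by (rule sum.cong) (auto simp: C_def True)
      then show ?thesis using ij True by (simp del: sum.lessThan_Suc)
    next
      case False
      with c have "c < e" by simp
      have "(\<Sum>r<Suc e. x r * C $$ (r, c)) = (\<Sum>r<Suc e. x r * N $$ (r, c))"
        by (rule sum.cong) (use \<open>c < e\<close> in \<open>auto simp: C_def\<close>)
      then show ?thesis using ker[OF \<open>c < e\<close>] False by (simp del: sum.lessThan_Suc)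
    qed
  qed
  also have "\<dots> = x j * cofactor C i e" by simp
  \<comment> \<open>The extra factor turns the cofactor sign \<open>(-1) ^ (k + e)\<close> into the
    sign \<open>(-1) ^ (k + 1)\<close> of the signed minors.\<close>
  finally have "x i * cofactor C j e * (-1) ^ (e + 1) = x j * cofactor C i e * (-1) ^ (e + 1)"
    using detC by simp
  moreover have "(-1) ^ (k + e) * D * (-1) ^ (e + 1) = (-1) ^ (k + 1) * (D :: 'b)" for k D
  proof -
    have "(-1 :: 'b) ^ e * (-1) ^ e = 1" by (simp flip: power_mult_distrib)
    then show ?thesis by (simp add: power_add algebra_simps)
  qed
  ultimately show ?thesis using cof ij by (simp add: mult.assoc)
qed

section \<open>Variables and degrees of determinants\<close>

lemma mvars_sum: "(\<And>i. i \<in> U \<Longrightarrow> mvars (g i) \<subseteq> V) \<Longrightarrow> mvars (sum g U) \<subseteq> V"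
proof (induction U rule: infinite_finite_induct)
  case (insert x U)
  then show ?case using mvars_add[of "g x" "sum g U"] by auto
qed (simp_all add: mvars_def)

lemma mvars_prod:
  fixes g :: "'i \<Rightarrow> 'a::comm_ring_1 mpoly"
  shows "(\<And>i. i \<in> U \<Longrightarrow> mvars (g i) \<subseteq> V) \<Longrightarrow> mvars (prod g U) \<subseteq> V"
proof (induction U rule: infinite_finite_induct)
  case (insert x U)
  then show ?case using mvars_mult[of "g x" "prod g U"] by auto
qed (simp_all add: mvars_def)

lemma mvars_uminus [simp]: "mvars (- P) = mvars (P :: 'a::comm_ring_1 mpoly)"
  by (simp add: mvars_def in_keys_iff set_eq_iff)

lemma homog_uminus [simp]: "homog n (- P) = homog n (P :: 'a::comm_ring_1 mpoly)"
  by (simp add: homog_def in_keys_iff)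

lemma mvars_det:
  fixes B :: "'a::comm_ring_1 mpoly mat"
  assumes B: "B \<in> carrier_mat n n" and "\<And>i j. i < n \<Longrightarrow> j < n \<Longrightarrow> mvars (B $$ (i, j)) \<subseteq> V"
  shows "mvars (det B) \<subseteq> V"
  unfolding det_def'[OF B]
proof (rule mvars_sum)
  fix \<pi> assume "\<pi> \<in> {\<pi>. \<pi> permutes {0..<n}}"
  then have "mvars (\<Prod>i = 0..<n. B $$ (i, \<pi> i)) \<subseteq> V"
    by (intro mvars_prod assms(2)) (auto dest: permutes_in_image)
  then show "mvars (signof \<pi> * (\<Prod>i = 0..<n. B $$ (i, \<pi> i))) \<subseteq> V"
    by (simp add: sign_def)
qed

text \<open>Every term of the Leibniz expansion uses each column once, so all terms have the same
  degree.\<close>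

lemma homog_det:
  fixes B :: "'a::comm_ring_1 mpoly mat"
  assumes B: "B \<in> carrier_mat n n" and "\<And>i j. i < n \<Longrightarrow> j < n \<Longrightarrow> homog (g j) (B $$ (i, j))"
  shows "homog (sum g {0..<n}) (det B)"
  unfolding det_def'[OF B]
proof (rule homog_sum)
  fix \<pi> assume "\<pi> \<in> {\<pi>. \<pi> permutes {0..<n}}"
  then have \<pi>: "\<pi> permutes {0..<n}" by simp
  have "homog (\<Sum>i = 0..<n. g (\<pi> i)) (\<Prod>i = 0..<n. B $$ (i, \<pi> i))"
    by (intro homog_prod assms(2)) (use \<pi> in \<open>auto dest: permutes_in_image\<close>)
  also have "(\<Sum>i = 0..<n. g (\<pi> i)) = sum g {0..<n}"
    using sum.permute[OF \<pi>, of g] by (simp add: o_def)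
  finally show "homog (sum g {0..<n}) (signof \<pi> * (\<Prod>i = 0..<n. B $$ (i, \<pi> i)))"
    by (simp add: sign_def)
qed

section \<open>Moving surfaces attached to the columns\<close>

lemma lookup_col_surface:
  "lookup (col_surface A \<alpha> i) \<gamma> = (\<Sum>j<dim_row A. single (\<alpha> j) (lookup (A $$ (j, i)) \<gamma>))"
  unfolding col_surface_def lookup_sum
  by (rule sum.cong) (auto simp: map.rep_eq when_def)

text \<open>The row monomials are distinct, so entries of different rows cannot cancel. Homogeneity
  of the surface thus passes to each entry.\<close>

lemma keys_entry_subset_col_surface:
  assumes "inj_on \<alpha> {..<dim_row A}" "j < dim_row A"
  shows "keys (A $$ (j, i)) \<subseteq> keys (col_surface A \<alpha> i)"
proof
  fix \<gamma> assume \<gamma>: "\<gamma> \<in> keys (A $$ (j, i))"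
  have "lookup (lookup (col_surface A \<alpha> i) \<gamma>) (\<alpha> j)
      = (\<Sum>k<dim_row A. if k = j then lookup (A $$ (j, i)) \<gamma> else 0)"
    unfolding lookup_col_surface lookup_sum
    by (rule sum.cong) (use assms in \<open>auto simp: lookup_single when_def inj_on_def\<close>)
  also have "\<dots> = lookup (A $$ (j, i)) \<gamma>" using assms by simp
  also have "\<dots> \<noteq> 0" using \<gamma> by (simp add: in_keys_iff)
  finally show "\<gamma> \<in> keys (col_surface A \<alpha> i)" by (auto simp: in_keys_iff)
qed

text \<open>Regrouping by row monomials instead of monomials in X, over the common support
  \<open>U\<close>, places the vector of row monomials in the left kernel of the substituted
  matrix.\<close>

lemma follows_col_surface:
  assumes "follows p (col_surface A \<alpha> i)"
  shows "(\<Sum>j<dim_row A. single (\<alpha> j) 1 * mpoly_subst (A $$ (j, i)) p) = 0"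
proof -
  define U where "U = keys (col_surface A \<alpha> i) \<union> (\<Union>j<dim_row A. keys (A $$ (j, i)))"
  have fin: "finite U" by (simp add: U_def)
  have "mpoly_subst (A $$ (j, i)) p = (\<Sum>\<gamma>\<in>U. single 0 (lookup (A $$ (j, i)) \<gamma>) * monom_eval p \<gamma>)"
    if "j < dim_row A" for j
    unfolding mpoly_subst_alt
    by (rule sum_keys_superset[OF fin, where f = "\<lambda>\<gamma> c. single 0 c * monom_eval p \<gamma>"])
      (use that in \<open>auto simp: U_def\<close>)
  then have "(\<Sum>j<dim_row A. single (\<alpha> j) 1 * mpoly_subst (A $$ (j, i)) p)
      = (\<Sum>j<dim_row A. \<Sum>\<gamma>\<in>U. single (\<alpha> j) (lookup (A $$ (j, i)) \<gamma>) * monom_eval p \<gamma>)"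
    by (simp add: sum_distrib_left mult_single flip: mult.assoc)
  also have "\<dots> = (\<Sum>\<gamma>\<in>U. lookup (col_surface A \<alpha> i) \<gamma> * monom_eval p \<gamma>)"
    by (subst sum.swap) (simp add: lookup_col_surface sum_distrib_right)
  also have "\<dots> = (\<Sum>\<gamma>\<in>keys (col_surface A \<alpha> i). lookup (col_surface A \<alpha> i) \<gamma> * monom_eval p \<gamma>)"
    by (rule sum_keys_superset[OF fin, symmetric, where f = "\<lambda>\<gamma> c. c * monom_eval p \<gamma>"])
      (auto simp: U_def)
  also have "\<dots> = 0" using assms by (simp add: follows_def monom_eval_def)
  finally show ?thesis .
qed

lemma card_Diff_1_eq:
  assumes "I \<subseteq> {..<Suc e}" "card I = e"
  obtains k where "k < Suc e" "I = {..<Suc e} - {k}"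
proof -
  have "card ({..<Suc e} - I) = 1"
    using assms finite_subset[OF assms(1)] by (simp add: card_Diff_subset)
  then obtain k where "{..<Suc e} - I = {k}" by (rule card_1_singletonE)
  then have "k < Suc e" "I = {..<Suc e} - {k}" using assms(1) by auto
  then show ?thesis by (rule that)
qed

text \<open>The greatest size is attained: the empty minor is 1, which \<open>F\<close> does not
  divide, and sizes are bounded by \<open>e\<close>. A minor of size \<open>e\<close> uses all
  columns and omits a single row.\<close>

lemma rank_KS_full:
  assumes "irreducible F" "dim_row A = Suc e" "dim_col A = e" "rank_KS F A = e"
  obtains k where "k < Suc e" "\<not> F dvd signed_minor A k"
proof -
  define Pr where "Pr = (\<lambda>r. \<exists>I J. I \<subseteq> {..<dim_row A} \<and> J \<subseteq> {..<dim_col A} \<and>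
      card I = r \<and> card J = r \<and> \<not> F dvd det (submatrix A I J))"
  have "submatrix A {} {} \<in> carrier_mat 0 0" by (auto simp: dim_submatrix)
  then have "det (submatrix A {} {}) = 1" by (rule det_dim_zero)
  moreover have "\<not> F dvd 1" using assms(1) by (rule irreducible_not_unit)
  ultimately have "Pr 0" unfolding Pr_def
    by - (rule exI[of _ "{}"], rule exI[of _ "{}"], simp)
  moreover have "r \<le> e" if "Pr r" for r
  proof -
    from that obtain J where "J \<subseteq> {..<e}" "card J = r" unfolding Pr_def assms(3) by blast
    then show ?thesis using card_mono[of "{..<e}" J] by simp
  qed
  ultimately have "Pr (Greatest Pr)" by (rule GreatestI_nat[of Pr 0 e])
  moreover have "Greatest Pr = e" using assms(4) unfolding rank_KS_def Pr_def .
  ultimately have "Pr e" by simp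
  then obtain I J where IJ: "I \<subseteq> {..<Suc e}" "J \<subseteq> {..<e}" "card I = e" "card J = e"
      "\<not> F dvd det (submatrix A I J)"
    unfolding Pr_def assms(2,3) by blast
  obtain k where k: "k < Suc e" "I = {..<Suc e} - {k}" by (rule card_Diff_1_eq[OF IJ(1,3)])
  have "J = {..<e}" using card_subset_eq[of "{..<e}" J] IJ(2,4) by simp
  have "signed_minor A k = (-1) ^ (k + 1) * det (submatrix A I J)"
    by (simp only: signed_minor_def k(2) \<open>J = {..<e}\<close> assms(2,3))
  then have "\<not> F dvd signed_minor A k"
    using IJ(5) by (cases "even k") simp_all
  with k(1) show ?thesis by (rule that)
qed

section \<open>The signed minors as an inverse of the parametrization\<close>

theorem theorem3p2:
  fixes p :: "nat \<Rightarrow> 'a::field_char_0 mpoly"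
    and F :: "'a mpoly" and A :: "'a mpoly mat"
    and d m b1 b2 b3 :: nat and \<alpha> :: "nat \<Rightarrow> (nat \<Rightarrow>\<^sub>0 nat)"
  assumes "param p" and "generically_finite p" and "implicit_eq p F"
    and "inversion_matrix p F A d m \<alpha> b1 b2 b3"
  shows "birational p F \<and>
    rational_inverse p F
      (\<lambda>i. if i = 0 then signed_minor A b1 else if i = 1 then signed_minor A b2 else signed_minor A b3)"
proof -
  let ?\<psi> = "\<lambda>P. mpoly_subst P p"
  have M: "dim_row A = d" "dim_col A = d - 1" "inj_on \<alpha> {..<d}" "b1 < d" "b2 < d" "b3 < d"
    "single 0 1 + \<alpha> b3 = single 2 1 + \<alpha> b1" "single 1 1 + \<alpha> b3 = single 2 1 + \<alpha> b2" "rank_KS F A = d - 1"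
    and Mvars: "\<And>j i. j < d \<Longrightarrow> i < d - 1 \<Longrightarrow> mvars (A $$ (j, i)) \<subseteq> {..<4}"
    and Msurf: "\<And>i. i < d - 1 \<Longrightarrow> \<exists>di. moving_surface m di (col_surface A \<alpha> i) \<and> follows p (col_surface A \<alpha> i)"
    using assms(4) unfolding inversion_matrix_def by blast+
  \<comment> \<open>\<open>b1 < d\<close> excludes \<open>d = 0\<close>, so \<open>d - 1\<close> is
    not truncated.\<close>
  obtain e where d: "d = Suc e" using M(4) by (cases d) auto
  have A: "A \<in> carrier_mat (Suc e) e" using M d by auto
  have irr: "irreducible F" using assms(3) by (simp add: implicit_eq_def)
  obtain n where n: "\<And>i. i < 4 \<Longrightarrow> mvars (p i) \<subseteq> {..<3}" "\<And>i. i < 4 \<Longrightarrow> homog n (p i)"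
    using assms(1) unfolding param_def by blast

  from Msurf obtain g where g: "\<And>i. i < e \<Longrightarrow> moving_surface m (g i) (col_surface A \<alpha> i)"
    and fol: "\<And>i. i < e \<Longrightarrow> follows p (col_surface A \<alpha> i)"
    using d by simp metis
  have homA: "homog (g i) (A $$ (j, i))" if "j < Suc e" "i < e" for i j
    using g[OF that(2)] keys_entry_subset_col_surface[of \<alpha> A j i] M d that
    by (auto simp: moving_surface_def homog_def)

  have minor: "signed_minor A k = (-1) ^ (k + 1) * det (row_delete A k)" if "k < Suc e" for k
    using submatrix_row_delete[of k A] M d that by (simp add: signed_minor_def)
  have rd: "row_delete A k \<in> carrier_mat e e" for k using A by (auto simp: row_delete_def)
  have sgn: "(-1) ^ k * P = P \<or> (-1) ^ k * P = - P" for k and P :: "'a mpoly"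
    by (cases "even k") auto
  have minor_vars: "mvars (signed_minor A k) \<subseteq> {..<4}" if "k < Suc e" for k
  proof -
    have "mvars (det (row_delete A k)) \<subseteq> {..<4}"
      by (rule mvars_det[OF rd]) (use A d that Mvars in \<open>auto simp: row_delete_def insert_index_def\<close>)
    then show ?thesis unfolding minor[OF that]
      using sgn[of "k + 1" "det (row_delete A k)"] by (metis mvars_uminus homog_uminus)
  qed
  \<comment> \<open>The degree depends on the columns alone, so all signed minors share it.\<close>
  have minor_homog: "homog (sum g {0..<e}) (signed_minor A k)" if "k < Suc e" for k
  proof -
    have "homog (sum g {0..<e}) (det (row_delete A k))"
      by (rule homog_det[OF rd]) (use A that in \<open>auto simp: row_delete_def insert_index_def intro!: homA\<close>)
    then show ?thesis unfolding minor[OF that]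
      using sgn[of "k + 1" "det (row_delete A k)"] by (metis mvars_uminus homog_uminus)
  qed

  define \<delta> where "\<delta> k = ?\<psi> (signed_minor A k)" for k
  let ?N = "map_mat ?\<psi> A"
  have \<delta>: "\<delta> k = (-1) ^ (k + 1) * det (row_delete ?N k)" if "k < Suc e" for k
  proof -
    have "row_delete ?N k = map_mat ?\<psi> (row_delete A k)"
      by (rule eq_matI) (use A that in \<open>auto simp: row_delete_def insert_index_def\<close>)
    then show ?thesis by (simp add: \<delta>_def minor[OF that] hom_distribs)
  qed
  have proportional: "single (\<alpha> i) 1 * \<delta> j = single (\<alpha> j) 1 * \<delta> i" if "i < Suc e" "j < Suc e" for i j
    unfolding \<delta>[OF that(1)] \<delta>[OF that(2)]
  proof (rule left_kernel_proportional_minors[OF _ _ that])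
    show "?N \<in> carrier_mat (Suc e) e" using A by simp
    show "(\<Sum>r<Suc e. single (\<alpha> r) 1 * ?N $$ (r, c)) = 0" if "c < e" for c
      using follows_col_surface[OF fol[OF that]] A that by (simp del: sum.lessThan_Suc)
  qed
  have single_nz: "single \<beta> 1 \<noteq> (0 :: 'a mpoly)" for \<beta>
    by (metis lookup_single_eq lookup_zero zero_neq_one)
  obtain k where k: "k < Suc e" "\<not> F dvd signed_minor A k"
    using rank_KS_full[OF irr, of A e] M d by auto
  then have "\<delta> k \<noteq> 0"
    unfolding \<delta>_def using implicit_eq_dvd_iff[OF assms(2,3) minor_vars] by simp
  \<comment> \<open>Proportionality to a vector of nonzero monomials spreads nonvanishing from one
    minor to all.\<close>
  then have \<delta>_nz: "\<delta> i \<noteq> 0" if "i < Suc e" for i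
    using proportional[OF that k(1)] single_nz by auto
  \<comment> \<open>Multiplying by the monomial of row \<open>b3\<close> reduces this to
    proportionality and the given relation between monomials. With 0-based indices,
    \<open>mvar 2\<close> is the third variable.\<close>
  have shift: "mvar 2 * \<delta> b = mvar j * \<delta> b3"
    if "b < Suc e" "single j 1 + \<alpha> b3 = single 2 1 + \<alpha> b" for b j
  proof -
    have mul: "mvar i * single \<beta> 1 = (single (single i 1 + \<beta>) 1 :: 'a mpoly)" for i \<beta>
      by (simp add: mvar_def mult_single)
    have "single (\<alpha> b3) 1 * (mvar 2 * \<delta> b) = mvar 2 * single (\<alpha> b) 1 * \<delta> b3"
      using proportional[of b3 b] that(1) M(6) d by (simp add: ac_simps)
    also have "\<dots> = single (\<alpha> b3) 1 * (mvar j * \<delta> b3)"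
      using mul[of 2 "\<alpha> b"] mul[of j "\<alpha> b3"] that(2) by (simp add: ac_simps)
    finally show ?thesis using single_nz by simp
  qed

  define q where "q = (\<lambda>i::nat. if i = 0 then signed_minor A b1 else if i = 1 then signed_minor A b2 else signed_minor A b3)"
  have q_minor: "\<exists>k<Suc e. q i = signed_minor A k" for i
    using M d by (auto simp: q_def)
  have q_vars: "mvars (q i) \<subseteq> {..<4}" for i using q_minor[of i] minor_vars by metis
  have q_eq: "mvar 2 * ?\<psi> (q i) = mvar i * \<delta> b3" if i: "i < 3" for i
  proof -
    consider "i = 0" | "i = 1" | "i = 2" using i by force
    then show ?thesis
      using shift[of b1 0] shift[of b2 1] M d by cases (auto simp: q_def \<delta>_def)
  qed
  have t2: "mvar 2 \<noteq> (0 :: 'a mpoly)" using single_nz by (simp add: mvar_def)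
  \<comment> \<open>Both sides are \<open>p i\<close> evaluated at one vector, seen as
    \<open>mvar 2\<close> times the substituted minors and as \<open>\<delta> b3\<close> times the
    variables.\<close>
  have scale: "mvar 2 ^ n * ?\<psi> (mpoly_subst (p i) q) = \<delta> b3 ^ n * p i" if "i < 4" for i
  proof -
    have "mvar 2 ^ n * ?\<psi> (mpoly_subst (p i) q) = mpoly_subst (p i) (\<lambda>k. mvar 2 * ?\<psi> (q k))"
      unfolding mpoly_subst_compose by (rule homog_subst_scale[OF n(2)[OF that], symmetric])
    also have "\<dots> = mpoly_subst (p i) (\<lambda>k. \<delta> b3 * mvar k)"
      by (rule mpoly_subst_cong[OF n(1)[OF that]]) (use q_eq in \<open>auto simp: mult.commute\<close>)
    also have "\<dots> = \<delta> b3 ^ n * p i"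
      by (simp add: homog_subst_scale[OF n(2)[OF that]] mpoly_subst_mvars_id)
    finally show ?thesis .
  qed
  have pq_vars: "mvars (mpoly_subst (p i) q) \<subseteq> {..<4}" if "i < 4" for i
    by (rule mvars_subst[OF n(1)[OF that]]) (rule q_vars)

  have "rational_inverse p F q"
    unfolding rational_inverse_def
  proof (intro conjI allI impI)
    show "mvars (q i) \<subseteq> {..<4}" for i by (rule q_vars)
    show "\<exists>n. \<forall>i<3. homog n (q i)" using q_minor minor_homog by metis
    show "\<exists>i<3. ?\<psi> (q i) \<noteq> 0"
      using \<delta>_nz[of b3] M d by (intro exI[of _ 2]) (simp add: q_def \<delta>_def)
    show "?\<psi> (q i) * mvar j = ?\<psi> (q j) * mvar i" if "i < 3" "j < 3" for i j
    proof -
      have "mvar 2 * (?\<psi> (q i) * mvar j) = mvar 2 * (?\<psi> (q j) * mvar i)"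
        using arg_cong[OF q_eq[OF that(1)], of "\<lambda>x. x * mvar j"] arg_cong[OF q_eq[OF that(2)], of "\<lambda>x. x * mvar i"]
        by (simp only: ac_simps)
      with t2 show ?thesis by simp
    qed
    show "\<exists>i<4. \<not> F dvd mpoly_subst (p i) q"
    proof -
      \<comment> \<open>If all \<open>p i\<close> were zero, the Jacobian would kill the vector of
        ones.\<close>
      have "\<exists>i<4. p i \<noteq> 0"
        using generically_finite_jacobian[OF assms(2), of "\<lambda>_. 1" 0] by fastforce
      then obtain i where i: "i < 4" "p i \<noteq> 0" by blast
      then have "mvar 2 ^ n * ?\<psi> (mpoly_subst (p i) q) \<noteq> 0"
        unfolding scale[OF i(1)] using \<delta>_nz[of b3] M d by simp
      then have "\<not> F dvd mpoly_subst (p i) q"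
        using implicit_eq_dvd_iff[OF assms(2,3) pq_vars[OF i(1)]] by auto
      with i(1) show ?thesis by blast
    qed
    show "F dvd mpoly_subst (p i) q * mvar j - mpoly_subst (p j) q * mvar i" if "i < 4" "j < 4" for i j
    proof -
      let ?G = "mpoly_subst (p i) q * mvar j - mpoly_subst (p j) q * mvar i"
      have "mvars ?G \<subseteq> {..<4}"
      proof -
        have "mvars (mpoly_subst (p k) q * mvar l) \<subseteq> {..<4}" if "k < 4" "l < 4" for k l
          using mvars_mult[of "mpoly_subst (p k) q" "mvar l"] pq_vars[OF that(1)] that(2)
          by (auto simp: mvars_mvar)
        from this[OF that] this[OF that(2,1)] show ?thesis
          using mvars_add[of "mpoly_subst (p i) q * mvar j" "- (mpoly_subst (p j) q * mvar i)"]
          by (simp only: mvars_uminus diff_conv_add_uminus) blast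
      qed
      moreover have "?\<psi> ?G = 0"
      proof -
        \<comment> \<open>By \<open>scale\<close> both products become
          \<open>\<delta> b3 ^ n * p i * p j\<close>.\<close>
        have "mvar 2 ^ n * ?\<psi> ?G = (mvar 2 ^ n * ?\<psi> (mpoly_subst (p i) q)) * p j
            - (mvar 2 ^ n * ?\<psi> (mpoly_subst (p j) q)) * p i"
          by (simp add: subst.hom_minus mpoly_subst_mult algebra_simps)
        also have "\<dots> = 0" unfolding scale[OF that(1)] scale[OF that(2)] by (simp add: algebra_simps)
        finally show ?thesis using t2 by simp
      qed
      ultimately show ?thesis using implicit_eq_dvd_iff[OF assms(2,3)] by blast
    qed
  qed
  then show ?thesis unfolding birational_def q_def by blast
qed

end
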